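(* There exist a compact metric space $K$, an open dense subset $U$ of $K$, and a sequence $(g_n)_{n\ge 1}$ in $C(K)$ such that: (a) the sequence of partial sums $\left(\sum_{i=1}^n g_i\right)_{n\ge 1}$ is uniformly bounded and converges pointwise on $K$ to a non-continuous function; (b) for every $u \in U$ there exists $n \in \mathbf{N}$ such that $g_m(u)=0$ for every $m \geq n$; (c) the closed linear span $[g_n]$ of $(g_n)$ in $C(K)$ is isomorphic to the James space $J$. Consequently, $c_0$ does not embed isomorphically in $[g_n]$.
   Context: All spaces are over the real numbers. $C(K)$ is the Banach space of real-valued continuous functions on $K$ with the supremum norm $\|\cdot\|_\infty$, and $[g_n]$ denotes the closed linear span of $(g_n)$ in $C(K)$. "Isomorphic" means linearly homeomorphic, and "$c_0$ embeds isomorphically in $X$" means that $X$ has a closed subspace linearly homeomorphic to $c_0$. The James (quasi-reflexive of order 1) space $J$: let $c_{00}$ be the space of finitely supported sequences of real numbers. For $(x_n)_{n\ge 1} \in c_{00}$ define $$\|(x_n)\|_J = \sup\left\{ \left[ x_{p_1}^2 + (x_{p_2}-x_{p_1})^2 + \cdots + (x_{p_k}-x_{p_{k-1}})^2 \right]^{1/2} : k \in \mathbf{N},\ 1 \le p_1 < p_2 < \cdots < p_k \right\}.$$ Then $J$ is the completion of $(c_{00}, \|\cdot\|_J)$. *)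

theory Defs
  imports "HOL-Analysis.Analysis"
begin

section \<open>The completion of a real normed space\<close>

definition cauchy_rel :: "(nat \<Rightarrow> 'a::real_normed_vector) \<Rightarrow> (nat \<Rightarrow> 'a) \<Rightarrow> bool" where
  "cauchy_rel X Y \<longleftrightarrow> Cauchy X \<and> Cauchy Y \<and> (\<lambda>n. X n - Y n) \<longlonglongrightarrow> 0"

lemma Cauchy_add: "Cauchy (\<lambda>n. X n + Y n)" if XY: "Cauchy X" "Cauchy Y"
  for X Y :: "nat \<Rightarrow> 'a::real_normed_vector"
proof (rule CauchyI)
  fix e :: real assume "e > 0"
  then have e2: "e / 2 > 0" by simp
  obtain M where M: "\<And>m n. m \<ge> M \<Longrightarrow> n \<ge> M \<Longrightarrow> norm (X m - X n) < e / 2"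
    using CauchyD[OF XY(1) e2] by blast
  obtain N where N: "\<And>m n. m \<ge> N \<Longrightarrow> n \<ge> N \<Longrightarrow> norm (Y m - Y n) < e / 2"
    using CauchyD[OF XY(2) e2] by blast
  have "norm (X m + Y m - (X n + Y n)) < e" if "m \<ge> max M N" "n \<ge> max M N" for m n
  proof -
    have "norm (X m + Y m - (X n + Y n)) \<le> norm (X m - X n) + norm (Y m - Y n)"
      by (metis add_diff_add norm_triangle_ineq)
    with M[of m n] N[of m n] that show ?thesis by simp
  qed
  then show "\<exists>M. \<forall>m\<ge>M. \<forall>n\<ge>M. norm (X m + Y m - (X n + Y n)) < e" by blast
qed

lemma Cauchy_scaleR: "Cauchy X \<Longrightarrow> Cauchy (\<lambda>n. c *\<^sub>R X n)"
  for X :: "nat \<Rightarrow> 'a::real_normed_vector"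
  by (rule bounded_linear.Cauchy[OF bounded_linear_scaleR_right])

lemma Cauchy_uminus: "Cauchy X \<Longrightarrow> Cauchy (\<lambda>n. - X n)"
  for X :: "nat \<Rightarrow> 'a::real_normed_vector"
  using Cauchy_scaleR[of X "-1"] by simp

lemma Cauchy_diff: "Cauchy X \<Longrightarrow> Cauchy Y \<Longrightarrow> Cauchy (\<lambda>n. X n - Y n)"
  for X Y :: "nat \<Rightarrow> 'a::real_normed_vector"
  using Cauchy_add[OF _ Cauchy_uminus, of X Y] by simp

lemma Cauchy_const: "Cauchy (\<lambda>n. c)" for c :: "'a::real_normed_vector"
  by (rule CauchyI) auto

lemma Cauchy_norm: "Cauchy X \<Longrightarrow> Cauchy (\<lambda>n. norm (X n))"
  for X :: "nat \<Rightarrow> 'a::real_normed_vector"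
  unfolding Cauchy_iff
  by (metis norm_triangle_ineq3 order_le_less_trans real_norm_def)

lemma convergent_norm_Cauchy: "Cauchy X \<Longrightarrow> convergent (\<lambda>n. norm (X n))"
  for X :: "nat \<Rightarrow> 'a::real_normed_vector"
  by (simp add: Cauchy_convergent Cauchy_norm)

lemma cauchy_rel_refl [simp]: "cauchy_rel X X \<longleftrightarrow> Cauchy X"
  by (simp add: cauchy_rel_def)

quotient_type (overloaded) 'a completion =
  "nat \<Rightarrow> 'a::real_normed_vector" / partial: cauchy_rel
proof (rule part_equivpI)
  show "\<exists>x :: nat \<Rightarrow> 'a. cauchy_rel x x"
    using Cauchy_const[of 0] by auto
  show "symp (cauchy_rel :: (nat \<Rightarrow> 'a) \<Rightarrow> _)"
  proof (rule sympI)
    fix X Y :: "nat \<Rightarrow> 'a" assume "cauchy_rel X Y"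
    then show "cauchy_rel Y X"
      unfolding cauchy_rel_def using tendsto_minus[of "\<lambda>n. X n - Y n" 0] by auto
  qed
  show "transp (cauchy_rel :: (nat \<Rightarrow> 'a) \<Rightarrow> _)"
  proof (rule transpI)
    fix X Y Z :: "nat \<Rightarrow> 'a" assume "cauchy_rel X Y" "cauchy_rel Y Z"
    then show "cauchy_rel X Z"
      unfolding cauchy_rel_def
      using tendsto_add[of "\<lambda>n. X n - Y n" 0 _ "\<lambda>n. Y n - Z n" 0] by auto
  qed
qed

lemma cauchy_rel_lim_norm:
  assumes "cauchy_rel X Y"
  shows "lim (\<lambda>n. norm (X n)) = lim (\<lambda>n. norm (Y n))"
proof -
  from assms have X: "Cauchy X" and Y: "Cauchy Y" and 0: "(\<lambda>n. X n - Y n) \<longlonglongrightarrow> 0"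
    by (auto simp: cauchy_rel_def)
  have "(\<lambda>n. norm (X n) - norm (Y n)) \<longlonglongrightarrow> 0"
  proof (rule Lim_null_comparison)
    show "\<forall>\<^sub>F n in sequentially. norm (norm (X n) - norm (Y n)) \<le> norm (X n - Y n)"
      by (simp add: norm_triangle_ineq3)
    show "(\<lambda>n. norm (X n - Y n)) \<longlonglongrightarrow> 0"
      using tendsto_norm[OF 0] by simp
  qed
  moreover have "(\<lambda>n. norm (Y n)) \<longlonglongrightarrow> lim (\<lambda>n. norm (Y n))"
    using convergent_norm_Cauchy[OF Y] by (simp add: convergent_LIMSEQ_iff)
  ultimately have "(\<lambda>n. norm (X n)) \<longlonglongrightarrow> lim (\<lambda>n. norm (Y n))"
    using tendsto_add by fastforce
  then show ?thesis by (rule limI)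
qed

instantiation completion :: (real_normed_vector) real_normed_vector
begin

lift_definition zero_completion :: "'a completion" is "\<lambda>n. 0"
  by (simp add: Cauchy_const)

lift_definition plus_completion :: "'a completion \<Rightarrow> 'a completion \<Rightarrow> 'a completion"
  is "\<lambda>X Y n. X n + Y n"
  subgoal for X X' Y Y'
    unfolding cauchy_rel_def
    using tendsto_add[of "\<lambda>n. X n - X' n" 0 sequentially "\<lambda>n. Y n - Y' n" 0]
    by (auto simp: Cauchy_add algebra_simps)
  done

lift_definition minus_completion :: "'a completion \<Rightarrow> 'a completion \<Rightarrow> 'a completion"
  is "\<lambda>X Y n. X n - Y n"
  subgoal for X X' Y Y'
    unfolding cauchy_rel_def
    using tendsto_diff[of "\<lambda>n. X n - X' n" 0 sequentially "\<lambda>n. Y n - Y' n" 0]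
    by (auto simp: Cauchy_diff algebra_simps)
  done

lift_definition uminus_completion :: "'a completion \<Rightarrow> 'a completion"
  is "\<lambda>X n. - X n"
  subgoal for X X'
    unfolding cauchy_rel_def
    using tendsto_minus[of "\<lambda>n. X n - X' n" 0 sequentially]
    by (auto simp: Cauchy_uminus algebra_simps)
  done

lift_definition scaleR_completion :: "real \<Rightarrow> 'a completion \<Rightarrow> 'a completion"
  is "\<lambda>c X n. c *\<^sub>R X n"
  subgoal for c X X'
    unfolding cauchy_rel_def
    using tendsto_scaleR[OF tendsto_const, of "\<lambda>n. X n - X' n" 0 sequentially c]
    by (auto simp: Cauchy_scaleR algebra_simps)
  done

lift_definition norm_completion :: "'a completion \<Rightarrow> real"
  is "\<lambda>X. lim (\<lambda>n. norm (X n))"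
  by (rule cauchy_rel_lim_norm)

definition dist_completion :: "'a completion \<Rightarrow> 'a completion \<Rightarrow> real"
  where "dist_completion x y = norm (x - y)"

definition sgn_completion :: "'a completion \<Rightarrow> 'a completion"
  where "sgn_completion x = inverse (norm x) *\<^sub>R x"

definition uniformity_completion :: "('a completion \<times> 'a completion) filter"
  where "uniformity_completion = (INF e\<in>{0<..}. principal {(x, y). dist x y < e})"

definition open_completion :: "'a completion set \<Rightarrow> bool"
  where "open_completion S = (\<forall>x\<in>S. \<forall>\<^sub>F (x', y) in uniformity. x' = x \<longrightarrow> y \<in> S)"

instance
proof
  fix x y z :: "'a completion" and a b :: real
  show "x + y + z = x + (y + z)"
    by transfer (auto simp: cauchy_rel_def Cauchy_add algebra_simps)
  show "x + y = y + x"
    by transfer (auto simp: cauchy_rel_def Cauchy_add algebra_simps)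
  show "0 + x = x"
    by transfer (auto simp: cauchy_rel_def)
  show "- x + x = 0"
    by transfer (auto simp: cauchy_rel_def Cauchy_const)
  show "x - y = x + - y"
    by transfer (auto simp: cauchy_rel_def Cauchy_diff Cauchy_add Cauchy_uminus)
  show "a *\<^sub>R (x + y) = a *\<^sub>R x + a *\<^sub>R y"
    by transfer (auto simp: cauchy_rel_def Cauchy_add Cauchy_scaleR scaleR_add_right)
  show "(a + b) *\<^sub>R x = a *\<^sub>R x + b *\<^sub>R x"
    by transfer (auto simp: cauchy_rel_def Cauchy_add Cauchy_scaleR scaleR_add_left)
  show "a *\<^sub>R b *\<^sub>R x = (a * b) *\<^sub>R x"
    by transfer (auto simp: cauchy_rel_def Cauchy_scaleR)
  show "1 *\<^sub>R x = x"
    by transfer (auto simp: cauchy_rel_def)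
  show "dist x y = norm (x - y)"
    by (fact dist_completion_def)
  show "sgn x = inverse (norm x) *\<^sub>R x"
    by (fact sgn_completion_def)
  show "uniformity = (INF e\<in>{0<..}. principal {(x :: 'a completion, y). dist x y < e})"
    by (fact uniformity_completion_def)
  show "open U \<longleftrightarrow> (\<forall>x\<in>U. \<forall>\<^sub>F (x', y) in uniformity. x' = x \<longrightarrow> y \<in> U)"
    for U :: "'a completion set"
    by (fact open_completion_def)
  show "norm x = 0 \<longleftrightarrow> x = 0"
  proof transfer
    fix X :: "nat \<Rightarrow> 'a" assume "cauchy_rel X X"
    then have X: "Cauchy X" by simp
    then have L: "(\<lambda>n. norm (X n)) \<longlonglongrightarrow> lim (\<lambda>n. norm (X n))"
      using convergent_norm_Cauchy by (auto simp: convergent_LIMSEQ_iff)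
    show "lim (\<lambda>n. norm (X n)) = 0 \<longleftrightarrow> cauchy_rel X (\<lambda>n. 0)"
    proof
      assume "lim (\<lambda>n. norm (X n)) = 0"
      with L have "X \<longlonglongrightarrow> 0" using tendsto_norm_zero_iff by fastforce
      then show "cauchy_rel X (\<lambda>n. 0)" using X by (simp add: cauchy_rel_def Cauchy_const)
    next
      assume "cauchy_rel X (\<lambda>n. 0)"
      then have "X \<longlonglongrightarrow> 0" by (simp add: cauchy_rel_def)
      then have "(\<lambda>n. norm (X n)) \<longlonglongrightarrow> 0" using tendsto_norm_zero by blast
      then show "lim (\<lambda>n. norm (X n)) = 0" by (rule limI)
    qed
  qed
  show "norm (x + y) \<le> norm x + norm y"
  proof transfer
    fix X Y :: "nat \<Rightarrow> 'a" assume "cauchy_rel X X" "cauchy_rel Y Y"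
    then have X: "Cauchy X" and Y: "Cauchy Y" by auto
    have LX: "(\<lambda>n. norm (X n)) \<longlonglongrightarrow> lim (\<lambda>n. norm (X n))"
      using convergent_norm_Cauchy[OF X] by (simp add: convergent_LIMSEQ_iff)
    have LY: "(\<lambda>n. norm (Y n)) \<longlonglongrightarrow> lim (\<lambda>n. norm (Y n))"
      using convergent_norm_Cauchy[OF Y] by (simp add: convergent_LIMSEQ_iff)
    have L: "(\<lambda>n. norm (X n + Y n)) \<longlonglongrightarrow> lim (\<lambda>n. norm (X n + Y n))"
      using convergent_norm_Cauchy[OF Cauchy_add[OF X Y]] by (simp add: convergent_LIMSEQ_iff)
    show "lim (\<lambda>n. norm (X n + Y n)) \<le> lim (\<lambda>n. norm (X n)) + lim (\<lambda>n. norm (Y n))"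
      by (rule LIMSEQ_le[OF L tendsto_add[OF LX LY]]) (auto intro: norm_triangle_ineq)
  qed
  show "norm (a *\<^sub>R x) = \<bar>a\<bar> * norm x"
  proof transfer
    fix a :: real and X :: "nat \<Rightarrow> 'a" assume "cauchy_rel X X"
    then have X: "Cauchy X" by auto
    have LX: "(\<lambda>n. norm (X n)) \<longlonglongrightarrow> lim (\<lambda>n. norm (X n))"
      using convergent_norm_Cauchy[OF X] by (simp add: convergent_LIMSEQ_iff)
    show "lim (\<lambda>n. norm (a *\<^sub>R X n)) = \<bar>a\<bar> * lim (\<lambda>n. norm (X n))"
      using tendsto_mult[OF tendsto_const[of "\<bar>a\<bar>"] LX] by (auto intro: limI)
  qed
qed

end

lift_definition to_completion :: "'a::real_normed_vector \<Rightarrow> 'a completion" is "\<lambda>x n. x"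
  by (simp add: Cauchy_const)

lemma linear_to_completion: "linear to_completion"
  by (rule linearI; transfer) (auto simp: cauchy_rel_def Cauchy_const)

lemma norm_to_completion [simp]: "norm (to_completion x) = norm x"
  by transfer simp

lemma to_completion_diff: "to_completion (x - y) = to_completion x - to_completion y"
  by (rule linear_diff[OF linear_to_completion])

lemma dist_to_completion [simp]: "dist (to_completion x) (to_completion y) = dist x y"
  by (metis dist_norm norm_to_completion to_completion_diff)

lemma to_completion_tendsto:
  assumes "Cauchy X"
  shows "(\<lambda>n. to_completion (X n)) \<longlonglongrightarrow> abs_completion X"
proof (rule metric_LIMSEQ_I)
  fix e :: real assume "e > 0"
  then obtain M where M: "\<And>m n. m \<ge> M \<Longrightarrow> n \<ge> M \<Longrightarrow> norm (X m - X n) < e / 2"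
    using CauchyD[OF assms, of "e / 2"] by auto
  have "dist (to_completion (X n)) (abs_completion X) < e" if "n \<ge> M" for n
  proof -
    have *: "Cauchy (\<lambda>m. X n - X m)"
      by (rule Cauchy_diff[OF Cauchy_const assms])
    have "to_completion (X n) - abs_completion X = abs_completion (\<lambda>m. X n - X m)"
      by (simp add: to_completion.abs_eq minus_completion.abs_eq Cauchy_const assms)
    then have "dist (to_completion (X n)) (abs_completion X) = lim (\<lambda>m. norm (X n - X m))"
      by (simp add: dist_norm norm_completion.abs_eq *)
    also have "\<dots> \<le> e / 2"
    proof (rule LIMSEQ_le_const2)
      show "(\<lambda>m. norm (X n - X m)) \<longlonglongrightarrow> lim (\<lambda>m. norm (X n - X m))"
        using convergent_norm_Cauchy[OF *] by (simp add: convergent_LIMSEQ_iff)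
      show "\<exists>N. \<forall>m\<ge>N. norm (X n - X m) \<le> e / 2"
        using M[OF that] by (intro exI[of _ M]) (auto intro: less_imp_le)
    qed
    finally show ?thesis using \<open>e > 0\<close> by simp
  qed
  then show "\<exists>N. \<forall>n\<ge>N. dist (to_completion (X n)) (abs_completion X) < e" by blast
qed

lemma to_completion_approx:
  assumes "e > 0"
  shows "\<exists>x. dist (to_completion x) z < e"
proof -
  obtain X where "Cauchy X" "z = abs_completion X"
    by (metis Quotient_completion Quotient_rel_rep Quotient_abs_rep cauchy_rel_refl)
  then show ?thesis
    using to_completion_tendsto[of X] assms
    by (metis LIMSEQ_iff_nz metric_LIMSEQ_D order_refl)
qed

lemma closure_range_to_completion: "closure (range to_completion) = UNIV"
  using to_completion_approx by (fastforce simp: closure_approachable)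

instance completion :: (real_normed_vector) banach
proof
  fix Z :: "nat \<Rightarrow> 'a completion" assume Z: "Cauchy Z"
  have "\<forall>n. \<exists>x. dist (to_completion x) (Z n) < inverse (real (Suc n))"
    using to_completion_approx by (meson inverse_positive_iff_positive of_nat_0_less_iff zero_less_Suc)
  then obtain X where X: "\<And>n. dist (to_completion (X n)) (Z n) < inverse (real (Suc n))"
    by metis
  have 0: "(\<lambda>n. to_completion (X n) - Z n) \<longlonglongrightarrow> 0"
    by (rule Lim_null_comparison[OF _ LIMSEQ_inverse_real_of_nat])
       (use X in \<open>auto simp: dist_norm intro!: always_eventually less_imp_le\<close>)
  have "Cauchy (\<lambda>n. (to_completion (X n) - Z n) + Z n)"
    by (rule Cauchy_add[OF _ Z]) (use 0 in \<open>auto intro: LIMSEQ_imp_Cauchy\<close>)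
  then have "Cauchy (\<lambda>n. to_completion (X n))" by simp
  then have "Cauchy X" by (simp add: Cauchy_def)
  then have "(\<lambda>n. to_completion (X n)) \<longlonglongrightarrow> abs_completion X"
    by (rule to_completion_tendsto)
  from tendsto_diff[OF this 0] show "convergent Z"
    by (auto simp: convergent_def)
qed


section \<open>The James space\<close>

text \<open>Sequences are indexed from 0: coordinate \<open>n\<close> holds the term \<open>x_(n+1)\<close>.\<close>

typedef c00 = "{x :: nat \<Rightarrow> real. finite {n. x n \<noteq> 0}}"
  morphisms c00_nth Abs_c00
  by (rule exI[of _ "\<lambda>_. 0"]) simp

setup_lifting type_definition_c00

definition james_sum :: "(nat \<Rightarrow> real) \<Rightarrow> nat \<Rightarrow> (nat \<Rightarrow> nat) \<Rightarrow> real" where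
  "james_sum x k p = sqrt ((x (p 1))\<^sup>2 + (\<Sum>i=2..k. (x (p i) - x (p (i - 1)))\<^sup>2))"

definition james_norm :: "(nat \<Rightarrow> real) \<Rightarrow> real" where
  "james_norm x = Sup {james_sum x k p | k p. 1 \<le> k \<and> strict_mono_on {1..k} p}"

definition james_diff :: "(nat \<Rightarrow> real) \<Rightarrow> (nat \<Rightarrow> nat) \<Rightarrow> nat \<Rightarrow> real" where
  "james_diff x p i = (if i = 1 then x (p 1) else x (p i) - x (p (i - 1)))"

lemma james_sum_L2: "1 \<le> k \<Longrightarrow> james_sum x k p = L2_set (james_diff x p) {1..k}"
proof -
  assume "1 \<le> k"
  then have "{1..k} = insert 1 {2..k}" by auto
  then show ?thesis
    by (simp add: james_sum_def L2_set_def james_diff_def)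
qed

lemma james_sum_add: "1 \<le> k \<Longrightarrow> james_sum (\<lambda>n. x n + y n) k p \<le> james_sum x k p + james_sum y k p"
proof -
  assume k: "1 \<le> k"
  have "james_diff (\<lambda>n. x n + y n) p = (\<lambda>i. james_diff x p i + james_diff y p i)"
    by (auto simp: james_diff_def)
  then show ?thesis
    using k L2_set_triangle_ineq by (simp add: james_sum_L2)
qed

lemma james_sum_scale: "1 \<le> k \<Longrightarrow> james_sum (\<lambda>n. a * x n) k p = \<bar>a\<bar> * james_sum x k p"
proof -
  assume k: "1 \<le> k"
  have "james_diff (\<lambda>n. a * x n) p = (\<lambda>i. a * james_diff x p i)"
    by (auto simp: james_diff_def algebra_simps)
  then show ?thesis
    using k by (simp add: james_sum_L2 L2_set_def power_mult_distrib flip: sum_distrib_left)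
               (simp add: real_sqrt_mult)
qed

lemma james_sum_bdd:
  assumes fin: "finite {n. x n \<noteq> 0}"
  shows "bdd_above {james_sum x k p | k p. 1 \<le> k \<and> strict_mono_on {1..k} p}"
proof (rule bdd_aboveI)
  let ?B = "\<Sum>n | x n \<noteq> 0. \<bar>x n\<bar>"
  fix s assume "s \<in> {james_sum x k p | k p. 1 \<le> k \<and> strict_mono_on {1..k} p}"
  then obtain k p where s: "s = james_sum x k p" and k: "1 \<le> k"
    and p: "strict_mono_on {1..k} p" by blast
  have inj: "inj_on p {1..k}" by (rule strict_mono_on_imp_inj_on[OF p])
  have B: "(\<Sum>i\<in>A. \<bar>x (p i)\<bar>) \<le> ?B" if A: "A \<subseteq> {1..k}" for A
  proof -
    have finA: "finite A" using A finite_subset by blast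
    have "(\<Sum>i\<in>A. \<bar>x (p i)\<bar>) = (\<Sum>n\<in>p ` A. \<bar>x n\<bar>)"
      using sum.reindex[OF inj_on_subset[OF inj A], of "\<lambda>n. \<bar>x n\<bar>"] by simp
    also have "\<dots> = (\<Sum>n\<in>p ` A \<inter> {n. x n \<noteq> 0}. \<bar>x n\<bar>)"
      using finA by (intro sum.mono_neutral_right) auto
    also have "\<dots> \<le> ?B"
      using fin by (intro sum_mono2) auto
    finally show ?thesis .
  qed
  have "s \<le> (\<Sum>i\<in>{1..k}. \<bar>james_diff x p i\<bar>)"
    unfolding s james_sum_L2[OF k] by (rule L2_set_le_sum_abs)
  also have "\<dots> \<le> (\<Sum>i\<in>{1..k}. \<bar>x (p i)\<bar> + (if i = 1 then 0 else \<bar>x (p (i - 1))\<bar>))"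
    by (rule sum_mono) (auto simp: james_diff_def)
  also have "\<dots> = (\<Sum>i\<in>{1..k}. \<bar>x (p i)\<bar>) + (\<Sum>i\<in>{1..k}. if i = 1 then 0 else \<bar>x (p (i - 1))\<bar>)"
    by (rule sum.distrib)
  also have "(\<Sum>i\<in>{1..k}. if i = 1 then 0 else \<bar>x (p (i - 1))\<bar>) = (\<Sum>i\<in>{1..<k}. \<bar>x (p i)\<bar>)"
  proof -
    have "{1..k} = insert 1 {2..k}" using k by auto
    then have "(\<Sum>i\<in>{1..k}. if i = 1 then 0 else \<bar>x (p (i - 1))\<bar>) = (\<Sum>i\<in>{2..k}. \<bar>x (p (i - 1))\<bar>)"
      by (auto intro!: sum.cong)
    also have "\<dots> = (\<Sum>i\<in>{1..<k}. \<bar>x (p i)\<bar>)"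
      by (rule sum.reindex_bij_witness[where i = "\<lambda>i. i + 1" and j = "\<lambda>i. i - 1"]) auto
    finally show ?thesis .
  qed
  also have "(\<Sum>i\<in>{1..k}. \<bar>x (p i)\<bar>) + (\<Sum>i\<in>{1..<k}. \<bar>x (p i)\<bar>) \<le> ?B + ?B"
    by (intro add_mono B) auto
  finally show "s \<le> ?B + ?B" .
qed

lemma james_sums_nonempty:
  "{james_sum x k p | k p. 1 \<le> k \<and> strict_mono_on {1..k} p} \<noteq> {}"
proof -
  have "strict_mono_on {1..1::nat} (\<lambda>i. i :: nat)" by (auto simp: strict_mono_on_def)
  then show ?thesis by blast
qed

lemma james_sum_le_norm:
  "\<lbrakk>finite {n. x n \<noteq> 0}; 1 \<le> k; strict_mono_on {1..k} p\<rbrakk> \<Longrightarrow> james_sum x k p \<le> james_norm x"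
  unfolding james_norm_def by (rule cSup_upper[OF _ james_sum_bdd]) auto

lemma james_norm_least:
  "(\<And>k p. \<lbrakk>1 \<le> k; strict_mono_on {1..k} p\<rbrakk> \<Longrightarrow> james_sum x k p \<le> B) \<Longrightarrow> james_norm x \<le> B"
  unfolding james_norm_def by (rule cSup_least[OF james_sums_nonempty]) auto

lemma abs_le_james_norm:
  assumes "finite {n. x n \<noteq> 0}"
  shows "\<bar>x n\<bar> \<le> james_norm x"
  using james_sum_le_norm[OF assms, of 1 "\<lambda>_. n"]
  by (auto simp: james_sum_def strict_mono_on_def)

lemma james_norm_scale_le:
  assumes "finite {n. x n \<noteq> 0}"
  shows "james_norm (\<lambda>n. a * x n) \<le> \<bar>a\<bar> * james_norm x"
  by (rule james_norm_least)
     (use assms in \<open>auto simp: james_sum_scale intro!: mult_left_mono james_sum_le_norm\<close>)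

instantiation c00 :: real_normed_vector
begin

lift_definition zero_c00 :: c00 is "\<lambda>n. 0" by simp

lift_definition plus_c00 :: "c00 \<Rightarrow> c00 \<Rightarrow> c00" is "\<lambda>x y n. x n + y n"
  subgoal for x y
    by (rule finite_subset[of _ "{n. x n \<noteq> 0} \<union> {n. y n \<noteq> 0}"]) auto
  done

lift_definition minus_c00 :: "c00 \<Rightarrow> c00 \<Rightarrow> c00" is "\<lambda>x y n. x n - y n"
  subgoal for x y
    by (rule finite_subset[of _ "{n. x n \<noteq> 0} \<union> {n. y n \<noteq> 0}"]) auto
  done

lift_definition uminus_c00 :: "c00 \<Rightarrow> c00" is "\<lambda>x n. - x n" by simp

lift_definition scaleR_c00 :: "real \<Rightarrow> c00 \<Rightarrow> c00" is "\<lambda>a x n. a * x n"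
  subgoal for a x
    by (rule finite_subset[of _ "{n. x n \<noteq> 0}"]) auto
  done

lift_definition norm_c00 :: "c00 \<Rightarrow> real" is james_norm .

definition dist_c00 :: "c00 \<Rightarrow> c00 \<Rightarrow> real"
  where "dist_c00 x y = norm (x - y)"

definition sgn_c00 :: "c00 \<Rightarrow> c00"
  where "sgn_c00 x = inverse (norm x) *\<^sub>R x"

definition uniformity_c00 :: "(c00 \<times> c00) filter"
  where "uniformity_c00 = (INF e\<in>{0<..}. principal {(x, y). dist x y < e})"

definition open_c00 :: "c00 set \<Rightarrow> bool"
  where "open_c00 S = (\<forall>x\<in>S. \<forall>\<^sub>F (x', y) in uniformity. x' = x \<longrightarrow> y \<in> S)"

instance
proof
  fix x y z :: c00 and a b :: real
  show "x + y + z = x + (y + z)" "x + y = y + x" "0 + x = x" "- x + x = 0" "x - y = x + - y"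
    "a *\<^sub>R (x + y) = a *\<^sub>R x + a *\<^sub>R y" "(a + b) *\<^sub>R x = a *\<^sub>R x + b *\<^sub>R x"
    "a *\<^sub>R b *\<^sub>R x = (a * b) *\<^sub>R x" "1 *\<^sub>R x = x"
    by (transfer; auto simp: algebra_simps)+
  show "dist x y = norm (x - y)"
    by (fact dist_c00_def)
  show "sgn x = inverse (norm x) *\<^sub>R x"
    by (fact sgn_c00_def)
  show "uniformity = (INF e\<in>{0<..}. principal {(x :: c00, y). dist x y < e})"
    by (fact uniformity_c00_def)
  show "open U \<longleftrightarrow> (\<forall>x\<in>U. \<forall>\<^sub>F (x', y) in uniformity. x' = x \<longrightarrow> y \<in> U)" for U :: "c00 set"
    by (fact open_c00_def)
  show "norm x = 0 \<longleftrightarrow> x = 0"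
  proof transfer
    fix x :: "nat \<Rightarrow> real" assume fin: "finite {n. x n \<noteq> 0}"
    have "x = (\<lambda>n. 0)" if "james_norm x = 0"
      using abs_le_james_norm[OF fin] that by auto
    moreover have "james_norm (\<lambda>n. 0) = 0"
      using abs_le_james_norm[of "\<lambda>n. 0"] james_norm_least[of "\<lambda>n. 0" 0]
      by (auto simp: james_sum_def)
    ultimately show "james_norm x = 0 \<longleftrightarrow> x = (\<lambda>n. 0)" by auto
  qed
  show "norm (x + y) \<le> norm x + norm y"
  proof transfer
    fix x y :: "nat \<Rightarrow> real" assume fin: "finite {n. x n \<noteq> 0}" "finite {n. y n \<noteq> 0}"
    show "james_norm (\<lambda>n. x n + y n) \<le> james_norm x + james_norm y"
    proof (rule james_norm_least)
      fix k :: nat and p :: "nat \<Rightarrow> nat" assume kp: "1 \<le> k" "strict_mono_on {1..k} p"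
      show "james_sum (\<lambda>n. x n + y n) k p \<le> james_norm x + james_norm y"
        using james_sum_add[OF kp(1)] james_sum_le_norm[OF fin(1) kp] james_sum_le_norm[OF fin(2) kp]
        by (meson add_mono order_trans)
    qed
  qed
  show "norm (a *\<^sub>R x) = \<bar>a\<bar> * norm x"
  proof transfer
    fix a :: real and x :: "nat \<Rightarrow> real" assume fin: "finite {n. x n \<noteq> 0}"
    show "james_norm (\<lambda>n. a * x n) = \<bar>a\<bar> * james_norm x"
    proof (cases "a = 0")
      case True
      have "james_norm (\<lambda>n. 0) = 0"
        using abs_le_james_norm[of "\<lambda>n. 0"] james_norm_least[of "\<lambda>n. 0" 0]
        by (auto simp: james_sum_def)
      then show ?thesis using True by simp
    next
      case False
      then have "finite {n. a * x n \<noteq> 0}" using fin by simp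
      from james_norm_scale_le[OF this, of "inverse a"] False
      have "\<bar>a\<bar> * james_norm x \<le> james_norm (\<lambda>n. a * x n)"
        by (simp add: field_simps)
      with james_norm_scale_le[OF fin, of a] show ?thesis by simp
    qed
  qed
qed

end

type_synonym james = "c00 completion"


section \<open>Subspaces of $C(K)$\<close>

text \<open>
  For a compact metric space \<open>K\<close>, all continuous functions are bounded, so \<^term>\<open>cfunspace\<close> gives
  \<open>C(K)\<close> with the supremum metric. Its elements are extensional functions, i.e. they take the value
  \<^term>\<open>undefined\<close> outside \<open>K\<close>; vector operations are therefore restricted to \<open>K\<close>.
  A compact metric space has at most continuum many points, so every compact metric space is
  isometric to some \<open>K :: (nat \<Rightarrow> real) metric\<close>; the metric need not be related to the topology of
  the type \<open>nat \<Rightarrow> real\<close>.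
\<close>

abbreviation CK :: "'k metric \<Rightarrow> ('k \<Rightarrow> real) metric" where
  "CK K \<equiv> cfunspace (mtopology_of K) euclidean_metric"

definition closed_span :: "'k metric \<Rightarrow> (nat \<Rightarrow> 'k \<Rightarrow> real) \<Rightarrow> ('k \<Rightarrow> real) set" where
  "closed_span K g = mtopology_of (CK K) closure_of
     {(\<lambda>t\<in>mspace K. \<Sum>i<n. a i * g i t) | n a. True}"

definition closed_subspace :: "'k metric \<Rightarrow> ('k \<Rightarrow> real) set \<Rightarrow> bool" where
  "closed_subspace K B \<longleftrightarrow>
     closedin (mtopology_of (CK K)) B \<and> B \<noteq> {} \<and>
     (\<forall>f\<in>B. \<forall>h\<in>B. \<forall>a b. (\<lambda>t\<in>mspace K. a * f t + b * h t) \<in> B)"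

text \<open>Linear homeomorphisms from a linear subspace \<open>A\<close> of a normed space onto \<open>B \<subseteq> C(K)\<close>.\<close>

definition isomorphic_CK :: "'a::real_normed_vector set \<Rightarrow> 'k metric \<Rightarrow> ('k \<Rightarrow> real) set \<Rightarrow> bool" where
  "isomorphic_CK A K B \<longleftrightarrow>
     (\<exists>T. homeomorphic_map (top_of_set A) (subtopology (mtopology_of (CK K)) B) T \<and>
          (\<forall>x\<in>A. \<forall>y\<in>A. \<forall>a b. T (a *\<^sub>R x + b *\<^sub>R y) = (\<lambda>t\<in>mspace K. a * T x t + b * T y t)))"

definition c0 :: "(nat \<Rightarrow>\<^sub>C real) set" where
  "c0 = {x. apply_bcontfun x \<longlonglongrightarrow> 0}"

definition c0_embeds :: "'k metric \<Rightarrow> ('k \<Rightarrow> real) set \<Rightarrow> bool" where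
  "c0_embeds K X \<longleftrightarrow> (\<exists>B\<subseteq>X. closed_subspace K B \<and> isomorphic_CK c0 K B)"

end

theory Submission
  imports Defs
begin

text \<open>
  The James norm is computed by functionals \<open>u\<close> in the dual ball that are finitely supported in the
  coordinates, and countably many of them already suffice. Attaching an extra coordinate
  \<open>1 / (m + 1)\<close> to the \<open>m\<close>-th of them turns this weak* relatively compact set into a discrete one;
  \<open>K\<close> is its closure and \<open>U\<close> the discrete set itself. Evaluation embeds \<open>J\<close> isometrically into
  \<open>C(K)\<close>, with \<open>g\<^sub>n\<close> the image of the \<open>n\<close>-th unit vector. The partial sums converge pointwise because
  the unit vectors are shrinking; the limit is 1 at each coordinate functional but 0 at the origin,
  their limit. Finally \<open>c\<^sub>0\<close> does not embed in \<open>J\<close>, since well separated blocks in \<open>J\<close> satisfy a lower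
  2-estimate.
\<close>

section \<open>Square variation along lists\<close>

text \<open>The argument \<open>v\<close> is the value visited last; starting at
  \<open>v = 0\<close> turns the first square into that of the first entry, as in the James norm.
  With lists, index sequences can be concatenated and filtered without renumbering.\<close>

fun jvar :: "(nat \<Rightarrow> real) \<Rightarrow> real \<Rightarrow> nat list \<Rightarrow> real" where
  "jvar x v [] = 0"
| "jvar x v (p # ps) = (x p - v)\<^sup>2 + jvar x (x p) ps"

lemma jvar_nonneg: "0 \<le> jvar x v ps"
  by (induction ps arbitrary: v) auto

lemma jvar_append: "jvar x v (ps @ qs) = jvar x v ps + jvar x (last (v # map x ps)) qs"
  by (induction ps arbitrary: v) auto

lemma jvar_cong: "(\<And>p. p \<in> set ps \<Longrightarrow> x p = y p) \<Longrightarrow> jvar x v ps = jvar y v ps"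
  by (induction ps arbitrary: v) auto

lemma jvar_eq_0: "(\<And>p. p \<in> set ps \<Longrightarrow> x p = 0) \<Longrightarrow> jvar x 0 ps = 0"
  by (induction ps) auto

lemma james_sum_eq_jvar:
  assumes "1 \<le> k"
  shows "james_sum x k p = sqrt (jvar x 0 (map p [1..<Suc k]))"
proof -
  have "jvar x 0 (map p [1..<Suc k]) = (x (p 1))\<^sup>2 + (\<Sum>i=2..k. (x (p i) - x (p (i - 1)))\<^sup>2)"
    using assms
  proof (induction k rule: nat_induct_at_least)
    case base
    then show ?case by simp
  next
    case (Suc k)
    have "last (0 # map x (map p [1..<Suc k])) = x (p k)"
      using Suc.hyps by (simp add: last_map)
    moreover have "[1..<Suc (Suc k)] = [1..<Suc k] @ [Suc k]"
      by simp
    ultimately show ?case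
      using Suc by (simp only: map_append jvar_append) (simp add: algebra_simps)
  qed
  then show ?thesis by (simp add: james_sum_def)
qed

lemma jvar_le_james_norm:
  assumes fin: "finite {n. x n \<noteq> 0}" and ps: "sorted_wrt (<) ps"
  shows "jvar x 0 ps \<le> (james_norm x)\<^sup>2"
proof (cases "ps = []")
  case False
  \<comment> \<open>\<open>james_sum\<close> numbers positions from 1, lists from 0.\<close>
  define p where "p i = ps ! (i - 1)" for i
  have ne: "1 \<le> length ps" using False by (simp add: Suc_le_eq)
  have "strict_mono_on {1..length ps} p"
    using ps unfolding p_def by (intro strict_mono_onI sorted_wrt_nth_less[OF ps]) auto
  from james_sum_le_norm[OF fin ne this]
  have "sqrt (jvar x 0 (map p [1..<Suc (length ps)])) \<le> james_norm x"
    by (simp only: james_sum_eq_jvar[OF ne])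
  moreover have "map p [1..<Suc (length ps)] = ps"
    by (rule nth_equalityI) (auto simp: p_def simp del: upt_Suc)
  ultimately show ?thesis
    by (metis jvar_nonneg real_sqrt_ge_zero real_sqrt_pow2 power_mono)
qed simp

lemma james_norm_nonneg: "finite {n. x n \<noteq> 0} \<Longrightarrow> 0 \<le> james_norm x"
  using abs_le_james_norm[of x 0] by linarith

lemma james_norm_sq_le:
  assumes fin: "finite {n. x n \<noteq> 0}"
    and le: "\<And>ps. sorted_wrt (<) ps \<Longrightarrow> jvar x 0 ps \<le> A"
  shows "(james_norm x)\<^sup>2 \<le> A"
proof -
  have A: "0 \<le> A" using le[of "[]"] by simp
  have "james_norm x \<le> sqrt A"
  proof (rule james_norm_least)
    fix k :: nat and p :: "nat \<Rightarrow> nat"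
    assume k: "1 \<le> k" and p: "strict_mono_on {1..k} p"
    have "sorted_wrt (<) (map p [1..<Suc k])"
      unfolding sorted_wrt_map
      by (rule sorted_wrt_mono_rel[OF _ sorted_wrt_upt]) (use p in \<open>auto simp: strict_mono_on_def\<close>)
    then show "james_sum x k p \<le> sqrt A"
      using le by (simp only: james_sum_eq_jvar[OF k] real_sqrt_le_iff)
  qed
  then show ?thesis
    using A james_norm_nonneg[OF fin] by (metis power_mono real_sqrt_pow2)
qed

lemma finite_support_c00: "finite {n. c00_nth x n \<noteq> 0}"
  using c00_nth[of x] by simp

lemma jvar_le_norm: "sorted_wrt (<) ps \<Longrightarrow> jvar (c00_nth x) 0 ps \<le> (norm x)\<^sup>2"
  unfolding norm_c00.rep_eq by (rule jvar_le_james_norm[OF finite_support_c00])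

lemma norm_c00_sq_le: "(\<And>ps. sorted_wrt (<) ps \<Longrightarrow> jvar (c00_nth x) 0 ps \<le> A) \<Longrightarrow> (norm x)\<^sup>2 \<le> A"
  unfolding norm_c00.rep_eq by (rule james_norm_sq_le[OF finite_support_c00])

lemma abs_nth_le_norm: "\<bar>c00_nth x i\<bar> \<le> norm x"
  unfolding norm_c00.rep_eq by (rule abs_le_james_norm[OF finite_support_c00])

section \<open>Lower 2-estimate for separated supports\<close>

lemma jvar_le_cut:
  assumes "sorted_wrt (<) ps" "\<And>n. n \<ge> M \<Longrightarrow> x n = 0"
  shows "jvar x v ps \<le> jvar x v (filter (\<lambda>p. p < M) ps @ [M])"
  using assms(1)
proof (induction ps arbitrary: v)
  case Nil
  show ?case by simp
next
  case (Cons p ps)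
  show ?case
  proof (cases "p < M")
    case True
    then show ?thesis using Cons by simp
  next
    case False
    \<comment> \<open>From \<open>p\<close> on all values are 0, so the list pays only the drop from
      \<open>v\<close> to 0; the appended index \<open>M\<close> pays the same drop.\<close>
    with Cons.prems have "filter (\<lambda>p. p < M) ps = []" "jvar x 0 ps = 0"
      by (auto simp: filter_empty_conv intro!: jvar_eq_0 assms(2))
    then show ?thesis using False assms(2) by simp
  qed
qed

text \<open>Since the start value is 0 as well, the indices up to \<open>M\<close> form an initial
  run without increments.\<close>

lemma jvar_eq_cut:
  assumes "sorted_wrt (<) ps" "\<And>n. n \<le> M \<Longrightarrow> x n = 0"
  shows "jvar x 0 ps = jvar x 0 (filter (\<lambda>p. M < p) ps)"
  using assms(1)
proof (induction ps)
  case (Cons p ps)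
  show ?case
  proof (cases "M < p")
    case True
    with Cons.prems have "filter (\<lambda>p. M < p) ps = ps" by (auto simp: filter_id_conv)
    then show ?thesis using True by simp
  next
    case False
    then show ?thesis using Cons assms(2)[of p] by simp
  qed
qed simp

text \<open>A list for \<open>x\<close> and a list for \<open>y\<close> are joined through the index
  \<open>M\<close>, where both vectors vanish. There the running value returns to 0, so the two
  square variations add up to a single one for \<open>x + y\<close>.\<close>

lemma norm_add_lower_l2:
  assumes x: "\<And>n. n \<ge> M \<Longrightarrow> c00_nth x n = 0" and y: "\<And>n. n \<le> M \<Longrightarrow> c00_nth y n = 0"
  shows "(norm x)\<^sup>2 + (norm y)\<^sup>2 \<le> (norm (x + y))\<^sup>2"
proof -
  have *: "jvar (c00_nth x) 0 ps + jvar (c00_nth y) 0 qs \<le> (norm (x + y))\<^sup>2"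
    if ps: "sorted_wrt (<) ps" and qs: "sorted_wrt (<) qs" for ps qs
  proof -
    define as where "as = filter (\<lambda>p. p < M) ps @ [M]"
    define bs where "bs = filter (\<lambda>p. M < p) qs"
    have "sorted_wrt (<) (as @ bs)"
      unfolding as_def bs_def using ps qs
      by (auto simp: sorted_wrt_append sorted_wrt_filter)
    then have "jvar (c00_nth (x + y)) 0 (as @ bs) \<le> (norm (x + y))\<^sup>2"
      by (rule jvar_le_norm)
    moreover have "last (0 # map (c00_nth (x + y)) as) = 0"
      using x y by (simp add: as_def plus_c00.rep_eq)
    moreover have "jvar (c00_nth (x + y)) 0 as = jvar (c00_nth x) 0 as"
      by (rule jvar_cong) (auto simp: as_def plus_c00.rep_eq y)
    moreover have "jvar (c00_nth (x + y)) 0 bs = jvar (c00_nth y) 0 bs"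
      by (rule jvar_cong) (auto simp: bs_def plus_c00.rep_eq x)
    moreover have "jvar (c00_nth x) 0 ps \<le> jvar (c00_nth x) 0 as"
      unfolding as_def using jvar_le_cut[OF ps x] by simp
    moreover have "jvar (c00_nth y) 0 qs = jvar (c00_nth y) 0 bs"
      unfolding bs_def by (rule jvar_eq_cut[OF qs y])
    ultimately show ?thesis by (simp only: jvar_append)
  qed
  \<comment> \<open>The two suprema are taken one after the other: over lists for \<open>x\<close>
    with the list for \<open>y\<close> fixed, then over lists for \<open>y\<close>.\<close>
  have "(norm y)\<^sup>2 \<le> (norm (x + y))\<^sup>2 - (norm x)\<^sup>2"
  proof (rule norm_c00_sq_le)
    fix qs :: "nat list" assume qs: "sorted_wrt (<) qs"
    have "(norm x)\<^sup>2 \<le> (norm (x + y))\<^sup>2 - jvar (c00_nth y) 0 qs"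
      by (rule norm_c00_sq_le) (use *[OF _ qs] in \<open>simp add: le_diff_eq\<close>)
    then show "jvar (c00_nth y) 0 qs \<le> (norm (x + y))\<^sup>2 - (norm x)\<^sup>2" by simp
  qed
  then show ?thesis by simp
qed

section \<open>Truncations and plateau vectors\<close>

lift_definition trunc :: "nat \<Rightarrow> (nat \<Rightarrow> real) \<Rightarrow> c00" is "\<lambda>N f i. if i < N then f i else 0"
  subgoal for N f by (rule finite_subset[of _ "{..<N}"]) auto
  done

lemma sorted_eq_filter_append:
  fixes n :: "'a::linorder"
  assumes "sorted_wrt (<) ps"
  shows "ps = filter (\<lambda>p. p < n) ps @ filter (\<lambda>p. \<not> p < n) ps"
  using assms
proof (induction ps)
  case (Cons p ps)
  show ?case
  proof (cases "p < n")
    case False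
    with Cons.prems have "\<forall>q\<in>set ps. \<not> q < n" by auto
    then have "filter (\<lambda>p. p < n) ps = []" "filter (\<lambda>p. \<not> p < n) ps = ps"
      by (auto simp: filter_empty_conv)
    with False show ?thesis by simp
  qed (use Cons in simp)
qed simp

text \<open>A path that starts at height \<open>c\<close> and stays beyond \<open>n\<close> moves at
  most once: it drops from \<open>c\<close> to 0 when it passes \<open>m\<close>.\<close>

lemma jvar_block_le:
  assumes "sorted_wrt (<) ps" "\<forall>p\<in>set ps. n \<le> p"
    and z: "\<And>i. n \<le> i \<Longrightarrow> z i = (if i < m then c else 0)"
  shows "jvar z c ps \<le> c\<^sup>2"
  using assms(1,2)
proof (induction ps)
  case (Cons p ps)
  show ?case
  proof (cases "p < m")
    case True
    then show ?thesis using Cons z[of p] by simp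
  next
    case False
    then have "jvar z 0 ps = 0"
      using Cons.prems z by (intro jvar_eq_0) force
    then show ?thesis using False Cons.prems z[of p] by simp
  qed
qed simp

text \<open>Appending one more plateau to a step function bounded by 1 adds at most two nonzero
  increments, of sizes at most 2 and 1.\<close>

lemma norm_append_block:
  assumes w: "\<And>i. \<bar>c00_nth w i\<bar> \<le> 1" and c: "\<bar>c\<bar> \<le> 1" and nm: "n \<le> m"
  shows "(norm (trunc m (\<lambda>i. if i < n then c00_nth w i else c)))\<^sup>2 \<le> (norm w)\<^sup>2 + 5"
    (is "(norm ?z)\<^sup>2 \<le> _")
proof -
  let ?f = "c00_nth ?z"
  show ?thesis
  proof (rule norm_c00_sq_le)
    fix ps :: "nat list" assume ps: "sorted_wrt (<) ps"
    define as bs where "as = filter (\<lambda>p. p < n) ps" and "bs = filter (\<lambda>p. \<not> p < n) ps"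
    have eq: "ps = as @ bs"
      unfolding as_def bs_def by (rule sorted_eq_filter_append[OF ps])
    have sas: "sorted_wrt (<) as" and sbs: "sorted_wrt (<) bs"
      using ps by (auto simp: as_def bs_def sorted_wrt_filter)
    have f: "?f i = (if i < m then c else 0)" if "n \<le> i" for i
      using that by (simp add: trunc.rep_eq)
    \<comment> \<open>Here \<open>v\<close> is the height at which the list leaves the old part.
      Entering the plateau and dropping from it costs at most 4 + 1; a list that skips the plateau
      pays only \<open>v\<^sup>2\<close>.\<close>
    have bd: "jvar ?f v bs \<le> 5" if v: "\<bar>v\<bar> \<le> 1" for v
    proof (cases bs)
      case Nil
      then show ?thesis by simp
    next
      case (Cons p qs)
      have p: "n \<le> p" and qs: "\<forall>q\<in>set qs. n \<le> q" "sorted_wrt (<) qs" "\<forall>q\<in>set qs. p < q"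
        using Cons sbs by (auto simp: bs_def filter_eq_Cons_iff)
      have c2: "c\<^sup>2 \<le> 1" and v2: "v\<^sup>2 \<le> 1"
        using c v by (auto simp: abs_square_le_1)
      show ?thesis
      proof (cases "p < m")
        case True
        have "\<bar>c - v\<bar> \<le> 2" using c v by linarith
        then have "(c - v)\<^sup>2 \<le> 2\<^sup>2" by (metis abs_le_square_iff abs_numeral)
        then show ?thesis
          using jvar_block_le[OF qs(2,1) f] c2 f[OF p] True Cons by simp
      next
        case False
        have "jvar ?f 0 qs = 0"
          using qs False f by (intro jvar_eq_0) force
        then show ?thesis using Cons f[OF p] False v2 by simp
      qed
    qed
    have "jvar ?f 0 as = jvar (c00_nth w) 0 as"
      by (rule jvar_cong) (use nm in \<open>auto simp: as_def trunc.rep_eq\<close>)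
    also have "\<dots> \<le> (norm w)\<^sup>2" by (rule jvar_le_norm[OF sas])
    finally have "jvar ?f 0 as \<le> (norm w)\<^sup>2" .
    moreover have "\<bar>last (0 # map ?f as)\<bar> \<le> 1"
    proof -
      have "last (0 # map ?f as) \<in> set (0 # map ?f as)" by (rule last_in_set) simp
      then show ?thesis using w c by (auto simp: trunc.rep_eq)
    qed
    ultimately show "jvar ?f 0 ps \<le> (norm w)\<^sup>2 + 5"
      unfolding eq jvar_append using bd by (intro add_mono)
  qed
qed

section \<open>Functionals on $c_{00}$\<close>

definition pairing :: "(nat \<Rightarrow> real) \<Rightarrow> c00 \<Rightarrow> real" where
  "pairing u x = (\<Sum>i | c00_nth x i \<noteq> 0. u i * c00_nth x i)"

lemma pairing_eq_sum:
  assumes "finite A" "\<And>i. i \<notin> A \<Longrightarrow> c00_nth x i = 0"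
  shows "pairing u x = (\<Sum>i\<in>A. u i * c00_nth x i)"
  unfolding pairing_def by (rule sum.mono_neutral_left) (use assms in auto)

lemma c00_bounded_support: "\<exists>N. \<forall>i\<ge>N. c00_nth x i = 0"
proof -
  obtain N where "\<forall>i\<in>{n. c00_nth x n \<noteq> 0}. i < N"
    using finite_support_c00[of x] finite_nat_bounded by blast
  then show ?thesis by (meson linorder_not_le mem_Collect_eq)
qed

lemma pairing_add: "pairing u (x + y) = pairing u x + pairing u y"
proof -
  let ?A = "{n. c00_nth x n \<noteq> 0} \<union> {n. c00_nth y n \<noteq> 0}"
  have "finite ?A" by (simp add: finite_support_c00)
  then show ?thesis
    by (subst (1 2 3) pairing_eq_sum[of ?A])
       (auto simp: plus_c00.rep_eq algebra_simps sum.distrib)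
qed

lemma pairing_scaleR: "pairing u (a *\<^sub>R x) = a * pairing u x"
  by (subst (1 2) pairing_eq_sum[of "{n. c00_nth x n \<noteq> 0}"])
     (auto simp: finite_support_c00 scaleR_c00.rep_eq sum_distrib_left algebra_simps)

lemma pairing_trunc: "pairing u (trunc N f) = (\<Sum>i<N. u i * f i)"
  by (subst pairing_eq_sum[of "{..<N}"]) (auto simp: trunc.rep_eq)

lemma trunc_nth: "\<forall>i\<ge>N. c00_nth x i = 0 \<Longrightarrow> trunc N (c00_nth x) = x"
  by (auto simp: trunc.rep_eq fun_eq_iff simp flip: c00_nth_inject)

lemma trunc_Suc: "trunc (Suc N) f = trunc N f + f N *\<^sub>R trunc (Suc N) (\<lambda>i. if i < N then 0 else 1)"
  by transfer (auto simp: fun_eq_iff less_Suc_eq)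

lemma norm_trunc_const_le: "\<bar>c\<bar> \<le> 1 \<Longrightarrow> n \<le> m \<Longrightarrow> norm (trunc m (\<lambda>i. if i < n then 0 else c)) \<le> 3"
proof -
  assume c: "\<bar>c\<bar> \<le> 1" "n \<le> m"
  \<comment> \<open>Appending the plateau to the zero vector gives squared norm at most 5, which is
    below 9.\<close>
  have "(norm (trunc m (\<lambda>i. if i < n then 0 else c)))\<^sup>2 \<le> 3\<^sup>2"
    using norm_append_block[of 0 c n m] c unfolding zero_c00.rep_eq by simp
  then show ?thesis by (rule power2_le_imp_le) simp
qed

text \<open>Coordinates are added one at a time, each with a unit vector of norm at most 3. The
  bound is crude, but it controls errors on finitely many coordinates.\<close>

lemma norm_trunc_le: "norm (trunc N f) \<le> 3 * (\<Sum>i<N. \<bar>f i\<bar>)"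
proof (induction N)
  case 0
  have "trunc 0 f = 0" by transfer simp
  then show ?case by simp
next
  case (Suc N)
  have "norm (trunc (Suc N) f) \<le> norm (trunc N f) + norm (f N *\<^sub>R trunc (Suc N) (\<lambda>i. if i < N then 0 else 1))"
    by (subst trunc_Suc) (rule norm_triangle_ineq)
  also have "\<dots> \<le> 3 * (\<Sum>i<N. \<bar>f i\<bar>) + \<bar>f N\<bar> * 3"
    using Suc norm_trunc_const_le[of 1 N "Suc N"] by (auto intro!: add_mono mult_left_mono)
  finally show ?case by simp
qed

section \<open>The dual unit ball, as sequences of values on the unit vectors\<close>

definition dual_ball :: "(nat \<Rightarrow> real) set" where
  "dual_ball = {u. \<forall>x. \<bar>pairing u x\<bar> \<le> norm x}"

lemma dual_ballD: "u \<in> dual_ball \<Longrightarrow> \<bar>pairing u x\<bar> \<le> norm x"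
  by (simp add: dual_ball_def)

lemma continuous_on_pairing: "continuous_on UNIV (\<lambda>u. pairing u x)"
  unfolding pairing_def
  by (intro continuous_intros continuous_on_product_then_coordinatewise)

text \<open>Each condition involves only finitely many coordinates of \<open>u\<close>. The product
  topology serves as the weak* topology on this ball.\<close>

lemma closed_dual_ball: "closed dual_ball"
  unfolding dual_ball_def
  by (intro closed_Collect_all closed_Collect_le continuous_intros continuous_on_pairing)

text \<open>A partial sum is the pairing with a plateau of height 1 starting at 0, and such plateaus
  have norm at most 3 whatever their length.\<close>

lemma abs_partial_sum_dual_ball_le:
  assumes "u \<in> dual_ball"
  shows "\<bar>\<Sum>i<n. u i\<bar> \<le> 3"
  using dual_ballD[OF assms, of "trunc n (\<lambda>i. if i < 0 then 0 else 1)"] norm_trunc_const_le[of 1 0 n]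
  by (simp add: pairing_trunc)

text \<open>A coordinate is the difference of two consecutive partial sums, hence 3 + 3. The uniform
  bound later gives compactness.\<close>

lemma abs_nth_dual_ball_le:
  assumes "u \<in> dual_ball"
  shows "\<bar>u n\<bar> \<le> 6"
  using abs_partial_sum_dual_ball_le[OF assms, of n] abs_partial_sum_dual_ball_le[OF assms, of "Suc n"]
  by simp

text \<open>These are the coordinate functionals. They tend to 0 coordinatewise although their full
  sums equal 1, which will break continuity of the limit.\<close>

lemma unit_in_dual_ball: "(\<lambda>i. if i = k then 1 else 0) \<in> dual_ball"
proof -
  have "pairing (\<lambda>i. if i = k then 1 else 0) x = c00_nth x k" for x
  proof -
    have "pairing (\<lambda>i. if i = k then 1 else 0) x
        = (\<Sum>i\<in>insert k {n. c00_nth x n \<noteq> 0}. (if i = k then 1 else 0) * c00_nth x i)"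
      by (rule pairing_eq_sum) (auto simp: finite_support_c00)
    also have "\<dots> = (\<Sum>i\<in>insert k {n. c00_nth x n \<noteq> 0}. if i = k then c00_nth x k else 0)"
      by (rule sum.cong) auto
    also have "\<dots> = c00_nth x k"
      by (subst sum.delta) (auto simp: finite_support_c00)
    finally show ?thesis .
  qed
  then show ?thesis by (simp add: dual_ball_def abs_nth_le_norm)
qed

text \<open>A sum over blocks pairing to at least \<open>\<epsilon>\<close> each grows linearly in the number of blocks,
  but its norm only like the square root.\<close>

lemma convergent_partial_sums_dual_ball:
  assumes u: "u \<in> dual_ball"
  shows "convergent (\<lambda>n. \<Sum>i<n. u i)"
proof (rule ccontr)
  let ?v = "\<lambda>n. \<Sum>i<n. u i"
  assume "\<not> convergent ?v"
  then have "\<not> Cauchy ?v" by (simp add: Cauchy_convergent_iff)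
  then obtain e where e: "e > 0" and "\<And>M. \<exists>m\<ge>M. \<exists>n\<ge>M. \<not> \<bar>?v m - ?v n\<bar> < e"
    unfolding Cauchy_iff real_norm_def by blast
  then have ex: "\<exists>n m. M \<le> n \<and> n \<le> m \<and> e \<le> \<bar>?v m - ?v n\<bar>" for M
    by (metis abs_minus_commute linorder_not_less nat_le_linear)
  \<comment> \<open>\<open>w\<close> carries \<open>N\<close> plateaus, placed one after the other.
    The height bound is kept in the induction because a further plateau costs at most 5 only under
    it.\<close>
  have step: "\<exists>w. (\<forall>i. \<bar>c00_nth w i\<bar> \<le> 1) \<and> (norm w)\<^sup>2 \<le> 5 * real N \<and> real N * e \<le> pairing u w" for N
  proof (induction N)
    case 0
    show ?case by (rule exI[of _ 0]) (simp add: pairing_def zero_c00.rep_eq)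
  next
    case (Suc N)
    then obtain w where w: "\<And>i. \<bar>c00_nth w i\<bar> \<le> 1" "(norm w)\<^sup>2 \<le> 5 * real N" "real N * e \<le> pairing u w"
      by blast
    obtain M where M: "\<And>i. i \<ge> M \<Longrightarrow> c00_nth w i = 0" using c00_bounded_support by blast
    obtain n m where nm: "M \<le> n" "n \<le> m" "e \<le> \<bar>?v m - ?v n\<bar>" using ex by blast
    \<comment> \<open>With this sign the new plateau pairs with \<open>u\<close> to the absolute
      value of the block sum.\<close>
    define c where "c = sgn (?v m - ?v n)"
    have c: "\<bar>c\<bar> \<le> 1" by (simp add: c_def sgn_if)
    let ?w = "trunc m (\<lambda>i. if i < n then c00_nth w i else c)"
    have "pairing u ?w = (\<Sum>i<n. u i * c00_nth w i) + (\<Sum>i\<in>{n..<m}. u i * c)"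
    proof -
      let ?F = "\<lambda>i. u i * (if i < n then c00_nth w i else c)"
      have "{..<m} = {..<n} \<union> {n..<m}" using nm by auto
      then have "sum ?F {..<m} = sum ?F {..<n} + sum ?F {n..<m}"
        by (simp only: sum.union_disjoint ivl_disj_int finite_lessThan finite_atLeastLessThan)
      also have "sum ?F {..<n} = (\<Sum>i<n. u i * c00_nth w i)" by (rule sum.cong) auto
      also have "sum ?F {n..<m} = (\<Sum>i\<in>{n..<m}. u i * c)" by (rule sum.cong) auto
      finally show ?thesis by (simp only: pairing_trunc)
    qed
    also have "(\<Sum>i<n. u i * c00_nth w i) = pairing u w"
      by (rule pairing_eq_sum[symmetric]) (use M nm in auto)
    also have "(\<Sum>i\<in>{n..<m}. u i * c) = c * (?v m - ?v n)"
      using sum_diff_nat_ivl[of 0 n m u] nm by (simp add: sum_distrib_left[symmetric] mult.commute atLeast0LessThan)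
    also have "\<dots> = \<bar>?v m - ?v n\<bar>" by (simp add: c_def mult.commute flip: abs_sgn)
    finally have "real (Suc N) * e \<le> pairing u ?w" using w nm by (simp add: algebra_simps)
    moreover have "(norm ?w)\<^sup>2 \<le> 5 * real (Suc N)"
      using norm_append_block[of w c n m, OF w(1) c nm(2)] w(2) by simp
    moreover have "\<bar>c00_nth ?w i\<bar> \<le> 1" for i
      using w c by (simp add: trunc.rep_eq)
    ultimately show ?case by blast
  qed
  \<comment> \<open>The vector \<open>w\<close> gives \<open>N * e\<close> at most the square root
    of \<open>5 * N\<close>, that is, \<open>N\<close> at most \<open>5 / e\<^sup>2\<close>; a
    larger \<open>N\<close> is contradictory.\<close>
  obtain N :: nat where N: "5 / e\<^sup>2 < real N" using reals_Archimedean2 by blast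
  have N0: "0 < real N" using N e by (smt (verit) divide_nonneg_nonneg zero_le_power2)
  obtain w where w: "(norm w)\<^sup>2 \<le> 5 * real N" "real N * e \<le> pairing u w" using step by blast
  have "real N * e \<le> norm w" using w(2) dual_ballD[OF u, of w] by linarith
  then have "(real N * e)\<^sup>2 \<le> (norm w)\<^sup>2" using e by (intro power_mono) auto
  then have "real N * (real N * e\<^sup>2) \<le> real N * 5" using w(1) by (simp add: power2_eq_square algebra_simps)
  then have "real N * e\<^sup>2 \<le> 5" using N0 by simp
  with N e show False by (simp add: field_simps)
qed

section \<open>Norming functionals\<close>

lemma ex_norming_functional:
  assumes "e > 0"
  shows "\<exists>u\<in>dual_ball. finite {i. u i \<noteq> 0} \<and> norm x - e \<le> pairing u x"
proof -
  let ?S = "{james_sum (c00_nth x) k p | k p. 1 \<le> k \<and> strict_mono_on {1..k} p}"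
  have "norm x - e < Sup ?S" using assms by (simp add: norm_c00.rep_eq james_norm_def)
  then obtain s where "s \<in> ?S" "norm x - e < s"
    using less_cSupE[OF _ james_sums_nonempty] by blast
  then obtain k p where k: "1 \<le> k" and p: "strict_mono_on {1..k} p"
    and s: "norm x - e < james_sum (c00_nth x) k p" by blast
  define D where "D = james_sum (c00_nth x) k p"
  \<comment> \<open>The equality case of Cauchy-Schwarz: weighting increments by the normalised
    increments of \<open>x\<close> gives a functional of norm at most 1 with value \<open>D\<close>
    at \<open>x\<close>. If \<open>D = 0\<close>, division yields \<open>b = 0\<close> and this
    stays true.\<close>
  define b where "b j = james_diff (c00_nth x) p j / D" for j
  \<comment> \<open>Coefficients of that functional: its values at the unit vectors.\<close>
  define u where "u i = (\<Sum>j=1..k. b j * james_diff (\<lambda>n. if n = i then 1 else 0) p j)" for i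
  have D: "D = L2_set (james_diff (c00_nth x) p) {1..k}" by (simp add: D_def james_sum_L2[OF k])
  have pairing_u: "pairing u y = (\<Sum>j=1..k. b j * james_diff (c00_nth y) p j)" for y
  proof -
    \<comment> \<open>The image of \<open>{0..k}\<close> contains both \<open>p j\<close> and
      \<open>p (j - 1)\<close> for every \<open>j\<close> in \<open>{1..k}\<close>.\<close>
    let ?A = "p ` {0..k} \<union> {n. c00_nth y n \<noteq> 0}"
    have fin: "finite ?A" by (simp add: finite_support_c00)
    have eval: "(\<Sum>i\<in>?A. (if n = i then 1 else 0) * c00_nth y i) = c00_nth y n" if "n \<in> ?A" for n
    proof -
      have "(\<Sum>i\<in>?A. (if n = i then 1 else 0) * c00_nth y i) = (\<Sum>i\<in>?A. if n = i then c00_nth y n else 0)"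
        by (rule sum.cong) auto
      also have "\<dots> = c00_nth y n" using that fin by (subst sum.delta') auto
      finally show ?thesis .
    qed
    have diff: "(\<Sum>i\<in>?A. james_diff (\<lambda>n. if n = i then 1 else 0) p j * c00_nth y i) = james_diff (c00_nth y) p j"
      if j: "j \<in> {1..k}" for j
    proof (cases "j = 1")
      case True
      have "p 1 \<in> ?A" using k by auto
      from eval[OF this] True show ?thesis by (simp only: james_diff_def if_True simp_thms)
    next
      case False
      have "p j \<in> ?A" "p (j - 1) \<in> ?A" using j by auto
      note eval[OF this(1)] eval[OF this(2)]
      with False show ?thesis
        by (simp only: james_diff_def if_False left_diff_distrib sum_subtractf)
    qed
    have "pairing u y = (\<Sum>i\<in>?A. u i * c00_nth y i)"
      by (rule pairing_eq_sum[OF fin]) auto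
    also have "\<dots> = (\<Sum>j=1..k. \<Sum>i\<in>?A. b j * (james_diff (\<lambda>n. if n = i then 1 else 0) p j * c00_nth y i))"
      by (simp only: u_def sum_distrib_right mult.assoc) (rule sum.swap)
    also have "\<dots> = (\<Sum>j=1..k. b j * james_diff (c00_nth y) p j)"
      by (rule sum.cong) (simp_all only: diff flip: sum_distrib_left)
    finally show ?thesis .
  qed
  have b: "L2_set b {1..k} \<le> 1"
  proof -
    have "b = (\<lambda>j. (1 / D) * james_diff (c00_nth x) p j)" by (simp add: b_def fun_eq_iff)
    then have "L2_set b {1..k} = \<bar>1 / D\<bar> * D"
      by (simp only: D) (simp add: L2_set_def power_divide real_sqrt_divide flip: sum_divide_distrib)
    then show ?thesis by (cases "D = 0") (simp_all add: D)
  qed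
  have "u \<in> dual_ball"
  proof -
    have "\<bar>pairing u y\<bar> \<le> norm y" for y
    proof -
      have "\<bar>pairing u y\<bar> \<le> (\<Sum>j=1..k. \<bar>b j\<bar> * \<bar>james_diff (c00_nth y) p j\<bar>)"
        unfolding pairing_u by (rule order_trans[OF sum_abs]) (simp add: abs_mult)
      also have "\<dots> \<le> L2_set b {1..k} * L2_set (james_diff (c00_nth y) p) {1..k}"
        by (rule L2_set_mult_ineq)
      also have "\<dots> \<le> 1 * norm y"
        unfolding norm_c00.rep_eq james_sum_L2[OF k, symmetric]
        by (rule mult_mono[OF b james_sum_le_norm[OF finite_support_c00 k p]]) (simp_all add: james_sum_L2[OF k])
      finally show ?thesis by simp
    qed
    then show ?thesis by (simp add: dual_ball_def)
  qed
  moreover have "finite {i. u i \<noteq> 0}"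
  proof (rule finite_subset)
    show "{i. u i \<noteq> 0} \<subseteq> p ` {0..k}"
    proof
      fix i assume "i \<in> {i. u i \<noteq> 0}"
      then have "\<exists>j\<in>{1..k}. james_diff (\<lambda>n. if n = i then 1 else 0) p j \<noteq> (0::real)"
        unfolding u_def by (rule contrapos_pp) (simp add: sum.neutral)
      then obtain j where j: "j \<in> {1..k}" "james_diff (\<lambda>n. if n = i then 1 else 0) p j \<noteq> (0::real)"
        by blast
      then have "p j = i \<or> p (j - 1) = i" by (auto simp: james_diff_def split: if_splits)
      moreover have "j \<in> {0..k}" "j - 1 \<in> {0..k}" using j(1) by auto
      ultimately show "i \<in> p ` {0..k}" by blast
    qed
  qed simp
  moreover have "pairing u x = D"
  proof -
    have "pairing u x = (\<Sum>j=1..k. (james_diff (c00_nth x) p j)\<^sup>2) / D"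
      by (simp add: pairing_u b_def power2_eq_square sum_divide_distrib)
    also have "(\<Sum>j=1..k. (james_diff (c00_nth x) p j)\<^sup>2) = D\<^sup>2"
      by (simp add: D L2_set_def sum_nonneg)
    finally show ?thesis by (simp add: power2_eq_square)
  qed
  ultimately show ?thesis using s by (auto simp: D_def)
qed

lemma rational_c00_dense:
  assumes "e > 0"
  shows "\<exists>q :: rat list. norm (x - trunc (length q) (\<lambda>i. of_rat (q ! i))) \<le> e"
proof -
  obtain N where N: "\<forall>i\<ge>N. c00_nth x i = 0" using c00_bounded_support by blast
  \<comment> \<open>Tolerance per coordinate, chosen so that \<open>3 * N * d\<close> is at most
    \<open>e\<close>; \<open>Suc N\<close> keeps the denominator positive when
    \<open>N = 0\<close>.\<close>
  define d where "d = e / (3 * real (Suc N))"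
  have d: "d > 0" using assms by (simp add: d_def)
  have "\<exists>r :: rat. \<bar>c00_nth x i - of_rat r\<bar> \<le> d" for i
  proof -
    obtain r where "c00_nth x i - d < of_rat r" "of_rat r < c00_nth x i + d"
      using of_rat_dense[of "c00_nth x i - d" "c00_nth x i + d"] d by auto
    then show ?thesis by (intro exI[of _ r]) linarith
  qed
  then obtain r :: "nat \<Rightarrow> rat" where r: "\<And>i. \<bar>c00_nth x i - of_rat (r i)\<bar> \<le> d" by metis
  let ?q = "map r [0..<N]"
  have "x - trunc (length ?q) (\<lambda>i. of_rat (?q ! i)) = trunc N (\<lambda>i. c00_nth x i - of_rat (r i))"
    using N by (auto simp: trunc.rep_eq minus_c00.rep_eq fun_eq_iff simp flip: c00_nth_inject)
  moreover have "norm (trunc N (\<lambda>i. c00_nth x i - of_rat (r i))) \<le> 3 * (\<Sum>i<N. d)"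
    by (rule order_trans[OF norm_trunc_le]) (intro mult_left_mono sum_mono r, simp)
  moreover have "3 * (\<Sum>i<N. d) \<le> e"
    using assms by (simp add: d_def field_simps)
  ultimately show ?thesis by (intro exI[of _ ?q]) simp
qed

text \<open>One functional is picked for each rational vector and each tolerance
  \<open>1 / (n + 1)\<close>, and the coordinate functionals are added. Norming passes to all
  \<open>x\<close> by density, since functionals in the ball are 1-Lipschitz.\<close>

lemma countable_norming_set:
  obtains D where "countable D" "D \<subseteq> dual_ball" "\<And>u. u \<in> D \<Longrightarrow> finite {i. u i \<noteq> 0}"
    "\<And>k. (\<lambda>i. if i = k then 1 else 0) \<in> D" "\<And>x e. e > 0 \<Longrightarrow> \<exists>u\<in>D. norm x - e \<le> pairing u x"
proof -
  let ?r = "\<lambda>q :: rat list. trunc (length q) (\<lambda>i. of_rat (q ! i))"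
  have "\<forall>q n. \<exists>u. u \<in> dual_ball \<and> finite {i. u i \<noteq> 0} \<and> norm (?r q) - inverse (real (Suc n)) \<le> pairing u (?r q)"
    using ex_norming_functional by (metis inverse_positive_iff_positive of_nat_0_less_iff zero_less_Suc)
  then obtain U where U: "\<And>q n. U q n \<in> dual_ball" "\<And>q n. finite {i. U q n i \<noteq> 0}"
    "\<And>q n. norm (?r q) - inverse (real (Suc n)) \<le> pairing (U q n) (?r q)" by metis
  let ?D = "range (\<lambda>(q, n). U q n) \<union> range (\<lambda>k i. if i = k then 1 else 0)"
  have dense: "\<exists>u\<in>?D. norm x - e \<le> pairing u x" if e: "e > 0" for x e
  proof -
    \<comment> \<open>One third of \<open>e\<close> each: for the norm of \<open>x\<close> against
      that of its approximation, for the corresponding pairings, and for the tolerance.\<close>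
    obtain q where q: "norm (x - ?r q) \<le> e / 3" using rational_c00_dense[of "e / 3"] e by auto
    obtain n where n: "inverse (real (Suc n)) < e / 3" using reals_Archimedean[of "e / 3"] e by auto
    have "pairing (U q n) x = pairing (U q n) (?r q) + pairing (U q n) (x - ?r q)"
      by (simp flip: pairing_add)
    moreover have "\<bar>pairing (U q n) (x - ?r q)\<bar> \<le> e / 3"
      using dual_ballD[OF U(1)] q by (rule order_trans)
    moreover have "norm x \<le> norm (?r q) + norm (x - ?r q)"
      using norm_triangle_ineq[of "?r q" "x - ?r q"] by simp
    ultimately have "norm x - e \<le> pairing (U q n) x" using U(3)[of q n] q n by linarith
    then show ?thesis by blast
  qed
  show thesis
  proof (rule that[of ?D])
    show "countable ?D" by auto
    show "?D \<subseteq> dual_ball" using U(1) unit_in_dual_ball by auto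
    show "finite {i. u i \<noteq> 0}" if "u \<in> ?D" for u using that U(2) by auto
    show "(\<lambda>i. if i = k then 1 else 0) \<in> ?D" for k by blast
  qed (rule dense)
qed

section \<open>Extending functionals to the completion\<close>

lemma completion_limit_exists: "\<exists>X. Cauchy X \<and> (\<lambda>n. to_completion (X n)) \<longlonglongrightarrow> z"
proof -
  obtain X where "Cauchy X" "z = abs_completion X"
    by (metis Quotient_completion Quotient_rel_rep Quotient_abs_rep cauchy_rel_refl)
  then show ?thesis using to_completion_tendsto by blast
qed

text \<open>The continuous extension of \<open>f\<close>, read off along one chosen approximating
  sequence. For bounded linear \<open>f\<close> the choice does not matter, by
  \<open>cext_tendsto\<close>.\<close>

definition cext :: "('a::real_normed_vector \<Rightarrow> real) \<Rightarrow> 'a completion \<Rightarrow> real" where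
  "cext f z = lim (\<lambda>n. f ((SOME X. Cauchy X \<and> (\<lambda>n. to_completion (X n)) \<longlonglongrightarrow> z) n))"

text \<open>Two sequences with the same limit in the completion differ by a null sequence already in
  the original space, because the embedding is isometric.\<close>

lemma cext_tendsto:
  assumes f: "bounded_linear f" and X: "(\<lambda>n. to_completion (X n)) \<longlonglongrightarrow> z"
  shows "(\<lambda>n. f (X n)) \<longlonglongrightarrow> cext f z"
proof -
  define Y where "Y = (SOME X. Cauchy X \<and> (\<lambda>n. to_completion (X n)) \<longlonglongrightarrow> z)"
  have Y: "Cauchy Y" "(\<lambda>n. to_completion (Y n)) \<longlonglongrightarrow> z"
    using someI_ex[OF completion_limit_exists[of z]] by (auto simp: Y_def)
  have "Cauchy (\<lambda>n. f (Y n))" by (rule bounded_linear.Cauchy[OF f Y(1)])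
  then have fY: "(\<lambda>n. f (Y n)) \<longlonglongrightarrow> cext f z"
    unfolding cext_def Y_def[symmetric] by (simp add: Cauchy_convergent_iff convergent_LIMSEQ_iff)
  have "(\<lambda>n. to_completion (X n) - to_completion (Y n)) \<longlonglongrightarrow> 0"
    using tendsto_diff[OF X Y(2)] by simp
  from tendsto_norm[OF this] have "(\<lambda>n. norm (X n - Y n)) \<longlonglongrightarrow> 0"
    by (simp flip: to_completion_diff)
  then have "(\<lambda>n. X n - Y n) \<longlonglongrightarrow> 0"
    by (rule tendsto_norm_zero_cancel)
  then have "(\<lambda>n. f (X n - Y n)) \<longlonglongrightarrow> 0"
    by (rule bounded_linear.tendsto_zero[OF f])
  from tendsto_add[OF this fY] show ?thesis
    by (simp add: linear_diff[OF bounded_linear.linear[OF f]])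
qed

lemma cext_to_completion: "bounded_linear f \<Longrightarrow> cext f (to_completion x) = f x"
  using LIMSEQ_unique[OF cext_tendsto[of f "\<lambda>_. x" "to_completion x"] tendsto_const] by simp

lemma cext_linear:
  assumes f: "bounded_linear f"
  shows "cext f (a *\<^sub>R x + b *\<^sub>R y) = a * cext f x + b * cext f y"
proof -
  obtain X Y where X: "(\<lambda>n. to_completion (X n)) \<longlonglongrightarrow> x" and Y: "(\<lambda>n. to_completion (Y n)) \<longlonglongrightarrow> y"
    using completion_limit_exists[of x] completion_limit_exists[of y] by blast
  have "(\<lambda>n. to_completion (a *\<^sub>R X n + b *\<^sub>R Y n)) \<longlonglongrightarrow> a *\<^sub>R x + b *\<^sub>R y"
    unfolding linear_add[OF linear_to_completion] linear_scale[OF linear_to_completion]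
    by (intro tendsto_intros X Y)
  from cext_tendsto[OF f this] have "(\<lambda>n. a * f (X n) + b * f (Y n)) \<longlonglongrightarrow> cext f (a *\<^sub>R x + b *\<^sub>R y)"
    by (simp add: linear_add[OF bounded_linear.linear[OF f]] linear_scale[OF bounded_linear.linear[OF f]])
  moreover have "(\<lambda>n. a * f (X n) + b * f (Y n)) \<longlonglongrightarrow> a * cext f x + b * cext f y"
    by (intro tendsto_intros cext_tendsto[OF f] X Y)
  ultimately show ?thesis by (rule LIMSEQ_unique)
qed

lemma linear_cext:
  assumes "bounded_linear f"
  shows "linear (cext f)"
proof (rule linearI)
  show "cext f (x + y) = cext f x + cext f y" for x y
    using cext_linear[OF assms, of 1 x 1 y] by simp
  show "cext f (c *\<^sub>R x) = c *\<^sub>R cext f x" for c x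
    using cext_linear[OF assms, of c x 0 0] by simp
qed

lemma abs_cext_le:
  assumes f: "bounded_linear f" and le: "\<And>x. \<bar>f x\<bar> \<le> norm x"
  shows "\<bar>cext f z\<bar> \<le> norm z"
proof -
  obtain X where X: "(\<lambda>n. to_completion (X n)) \<longlonglongrightarrow> z"
    using completion_limit_exists[of z] by blast
  have "(\<lambda>n. \<bar>f (X n)\<bar>) \<longlonglongrightarrow> \<bar>cext f z\<bar>" by (intro tendsto_rabs cext_tendsto[OF f X])
  moreover have "(\<lambda>n. norm (X n)) \<longlonglongrightarrow> norm z" using tendsto_norm[OF X] by simp
  ultimately show ?thesis by (rule LIMSEQ_le) (use le in blast)
qed


section \<open>$c_0$ does not embed in the James space\<close>

lemma bounded_linear_c00_nth: "bounded_linear (\<lambda>x. c00_nth x i)"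
  by (rule bounded_linear_intro[where K=1])
     (auto simp: plus_c00.rep_eq scaleR_c00.rep_eq abs_nth_le_norm)

lemma eventually_notin_finite: "finite F \<Longrightarrow> \<forall>\<^sub>F n :: nat in sequentially. n \<notin> F"
  by (simp add: eventually_cofinite flip: cofinite_eq_sequentially)

text \<open>Gliding hump: bounded unconditional sums force coordinatewise null sequences, so well separated
  blocks can be extracted, and these satisfy a lower 2-estimate.\<close>

lemma james_no_c0_sequence:
  fixes z :: "nat \<Rightarrow> james"
  assumes bdd: "\<And>F a. finite F \<Longrightarrow> (\<And>k. \<bar>a k\<bar> \<le> 1) \<Longrightarrow> norm (\<Sum>k\<in>F. a k *\<^sub>R z k) \<le> C"
    and d: "0 < d" and lower: "\<And>n. d \<le> norm (z n)"
  shows False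
proof -
  define f where "f i = cext (\<lambda>x. c00_nth x i)" for i
  have lin: "linear (f i)" for i
    unfolding f_def by (rule linear_cext[OF bounded_linear_c00_nth])
  have f_le: "\<bar>f i x\<bar> \<le> norm x" for i x
    unfolding f_def by (rule abs_cext_le[OF bounded_linear_c00_nth abs_nth_le_norm])
  have f_c: "f i (to_completion x) = c00_nth x i" for i x
    unfolding f_def by (rule cext_to_completion[OF bounded_linear_c00_nth])
  \<comment> \<open>Choosing signs turns the sum of the absolute values into \<open>f i\<close> of
    an admissible combination, so the series is bounded by \<open>C\<close> and its terms tend to
    0.\<close>
  have null: "(\<lambda>n. \<bar>f i (z n)\<bar>) \<longlonglongrightarrow> 0" for i
  proof (rule summable_LIMSEQ_zero[OF summableI_nonneg_bounded])
    fix N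
    have "(\<Sum>n<N. \<bar>f i (z n)\<bar>) = f i (\<Sum>n<N. sgn (f i (z n)) *\<^sub>R z n)"
      by (simp add: linear_sum[OF lin] linear_scale[OF lin] abs_sgn mult.commute)
    also have "\<dots> \<le> norm (\<Sum>n<N. sgn (f i (z n)) *\<^sub>R z n)"
      using f_le abs_le_D1 by blast
    also have "\<dots> \<le> C" by (rule bdd) (auto simp: sgn_if)
    finally show "(\<Sum>n<N. \<bar>f i (z n)\<bar>) \<le> C" .
  qed simp
  \<comment> \<open>\<open>w\<close> is a finitely supported approximation of a sum of the
    \<open>z k\<close>, to which each of \<open>N\<close> blocks contributes at least
    \<open>(d / 2)\<^sup>2\<close>. The claim covers every \<open>e\<close>, since the induction
    step uses it for \<open>e / 2\<close>.\<close>
  have blocks: "\<forall>e>0. \<exists>F w. finite F \<and> norm ((\<Sum>k\<in>F. z k) - to_completion w) < e \<and>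
      real N * (d / 2)\<^sup>2 \<le> (norm w)\<^sup>2" for N
  proof (induction N)
    case 0
    have "to_completion 0 = (0 :: james)" by (rule linear_0[OF linear_to_completion])
    then show ?case
      by (intro allI impI exI[of _ "{} :: nat set"] exI[of _ "0 :: c00"]) simp
  next
    case (Suc N)
    show ?case
    proof (intro allI impI)
      fix e :: real assume e: "e > 0"
      then obtain F w where F: "finite F" and Fw: "norm ((\<Sum>k\<in>F. z k) - to_completion w) < e / 2"
        and w: "real N * (d / 2)\<^sup>2 \<le> (norm w)\<^sup>2"
        using Suc half_gt_zero by blast
      obtain M where M: "\<And>i. i \<ge> M \<Longrightarrow> c00_nth w i = 0" using c00_bounded_support by blast
      \<comment> \<open>The new block will have error at most \<open>7 * h\<close>: \<open>h\<close>
        for approximating \<open>z n\<close> and \<open>6 * h\<close> for removing initial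
        coordinates. Dividing by 16 keeps this below both \<open>e / 2\<close> and
        \<open>d / 2\<close>.\<close>
      define h where "h = min e d / 16"
      have h: "h > 0" using e d by (simp add: h_def)
      have "(\<lambda>n. \<Sum>i<Suc M. \<bar>f i (z n)\<bar>) \<longlonglongrightarrow> 0" by (rule tendsto_null_sum) (rule null)
      then have "\<forall>\<^sub>F n in sequentially. (\<Sum>i<Suc M. \<bar>f i (z n)\<bar>) < h"
        using h by (rule order_tendstoD)
      moreover have "\<forall>\<^sub>F n in sequentially. n \<notin> F"
        by (rule eventually_notin_finite[OF F])
      ultimately have "\<forall>\<^sub>F n in sequentially. (\<Sum>i<Suc M. \<bar>f i (z n)\<bar>) < h \<and> n \<notin> F"
        by (rule eventually_conj)
      then obtain n where n: "(\<Sum>i<Suc M. \<bar>f i (z n)\<bar>) < h" "n \<notin> F"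
        using eventually_happens by force
      \<comment> \<open>The \<open>Suc M\<close> initial coordinates may each be off by this
        tolerance, in total by \<open>h\<close>.\<close>
      obtain x where "dist (to_completion x) (z n) < h / real (Suc M)"
        using to_completion_approx[of "h / real (Suc M)"] h by auto
      then have x: "norm (z n - to_completion x) < h / real (Suc M)"
        by (simp add: dist_norm norm_minus_commute)
      have "h / real (Suc M) \<le> h" using h by (simp add: field_simps)
      with x have xh: "norm (z n - to_completion x) \<le> h" by linarith
      \<comment> \<open>The coordinates up to and including \<open>M\<close> are removed, so that
        \<open>M\<close> is a common zero of \<open>w\<close> and \<open>y\<close> as the lower
        2-estimate requires.\<close>
      define t where "t = trunc (Suc M) (c00_nth x)"
      have t3: "norm t \<le> 3 * (\<Sum>i<Suc M. \<bar>c00_nth x i\<bar>)"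
        unfolding t_def by (rule norm_trunc_le)
      have "(\<Sum>i<Suc M. \<bar>c00_nth x i\<bar>) \<le> (\<Sum>i<Suc M. \<bar>f i (z n)\<bar> + h / real (Suc M))"
      proof (rule sum_mono)
        fix i
        have "c00_nth x i = f i (z n) - f i (z n - to_completion x)"
          by (simp add: linear_diff[OF lin] f_c)
        then show "\<bar>c00_nth x i\<bar> \<le> \<bar>f i (z n)\<bar> + h / real (Suc M)"
          using f_le[of i "z n - to_completion x"] x by linarith
      qed
      also have "\<dots> = (\<Sum>i<Suc M. \<bar>f i (z n)\<bar>) + h"
        by (simp add: sum.distrib del: sum.lessThan_Suc of_nat_Suc)
      finally have t: "norm t \<le> 6 * h" using t3 n(1) by linarith
      define y where "y = x - t"
      have y0: "c00_nth y i = 0" if "i \<le> M" for i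
        using that by (simp add: y_def t_def minus_c00.rep_eq trunc.rep_eq)
      have "z n - to_completion y = (z n - to_completion x) + to_completion t"
        by (simp add: y_def to_completion_diff)
      then have "norm (z n - to_completion y) \<le> norm (z n - to_completion x) + norm t"
        by (metis norm_triangle_ineq norm_to_completion)
      then have ny: "norm (z n - to_completion y) \<le> 7 * h" using xh t by linarith
      have h7: "7 * h < e / 2" "7 * h < d / 2" using e d by (auto simp: h_def min_def)
      have "norm (z n) \<le> norm (z n - to_completion y) + norm y"
        using norm_triangle_ineq[of "z n - to_completion y" "to_completion y"] by simp
      then have "d / 2 \<le> norm y" using lower[of n] ny h7 by linarith
      then have "(d / 2)\<^sup>2 \<le> (norm y)\<^sup>2" using d by (intro power_mono) auto
      then have "real (Suc N) * (d / 2)\<^sup>2 \<le> (norm (w + y))\<^sup>2"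
        using norm_add_lower_l2[of M w y, OF M y0] w by (simp add: algebra_simps)
      moreover have "norm ((\<Sum>k\<in>insert n F. z k) - to_completion (w + y)) < e"
      proof -
        have "(\<Sum>k\<in>insert n F. z k) - to_completion (w + y)
            = ((\<Sum>k\<in>F. z k) - to_completion w) + (z n - to_completion y)"
          using F n(2) by (simp add: linear_add[OF linear_to_completion])
          with norm_triangle_ineq[of "(\<Sum>k\<in>F. z k) - to_completion w" "z n - to_completion y"]
          show ?thesis using Fw ny h7 by simp
      qed
      ultimately show "\<exists>F w. finite F \<and> norm ((\<Sum>k\<in>F. z k) - to_completion w) < e \<and>
          real (Suc N) * (d / 2)\<^sup>2 \<le> (norm w)\<^sup>2"
        using F by (intro exI[of _ "insert n F"] exI[of _ "w + y"]) simp
    qed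
  qed
  \<comment> \<open>The sum of the \<open>z k\<close> has norm at most \<open>C\<close>, so
    \<open>w\<close> has norm at most \<open>C + 1\<close>; this \<open>N\<close> makes the blocks
    exceed it.\<close>
  obtain N :: nat where N: "(C + 1)\<^sup>2 / (d / 2)\<^sup>2 < real N" using reals_Archimedean2 by blast
  obtain F w where F: "finite F" and Fw: "norm ((\<Sum>k\<in>F. z k) - to_completion w) < 1"
    and w: "real N * (d / 2)\<^sup>2 \<le> (norm w)\<^sup>2"
    using blocks[of N] zero_less_one by blast
  have "norm w \<le> norm (\<Sum>k\<in>F. z k) + norm ((\<Sum>k\<in>F. z k) - to_completion w)"
    by (metis norm_to_completion norm_triangle_sub norm_minus_commute)
  also have "norm (\<Sum>k\<in>F. z k) \<le> C" using bdd[OF F, of "\<lambda>_. 1"] by simp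
  finally have "norm w \<le> C + 1" using Fw by simp
  then have "(norm w)\<^sup>2 \<le> (C + 1)\<^sup>2" by (intro power_mono) auto
  moreover have "(C + 1)\<^sup>2 < real N * (d / 2)\<^sup>2"
    using N d by (simp add: divide_less_eq)
  ultimately show False using w by linarith
qed

section \<open>Reduction to the images of the unit vectors of \<open>c0\<close>\<close>

definition c0_unit :: "nat \<Rightarrow> (nat \<Rightarrow>\<^sub>C real)" where
  "c0_unit k = Bcontfun (\<lambda>i. if i = k then 1 else 0)"

lemma c0_unit_apply: "apply_bcontfun (c0_unit k) i = (if i = k then 1 else 0)"
  unfolding c0_unit_def
  by (subst Bcontfun_inverse) (rule bcontfun_normI[where b = 1], auto)

lemma sum_c0_unit_apply:
  "finite F \<Longrightarrow> apply_bcontfun (\<Sum>k\<in>F. a k *\<^sub>R c0_unit k) i = (if i \<in> F then a i else 0)"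
proof (induction F rule: finite_induct)
  case (insert k F)
  then show ?case by (auto simp: plus_bcontfun.rep_eq scaleR_bcontfun.rep_eq c0_unit_apply)
qed (simp add: zero_bcontfun.rep_eq)

lemma sum_c0_unit_in_c0:
  assumes "finite F"
  shows "(\<Sum>k\<in>F. a k *\<^sub>R c0_unit k) \<in> c0"
proof -
  have "\<forall>\<^sub>F i in sequentially. i \<notin> F"
    by (rule eventually_notin_finite[OF assms])
  then have "\<forall>\<^sub>F i in sequentially. apply_bcontfun (\<Sum>k\<in>F. a k *\<^sub>R c0_unit k) i = 0"
    by eventually_elim (simp add: sum_c0_unit_apply[OF assms])
  then show ?thesis by (simp add: c0_def tendsto_eventually)
qed

lemma c0_unit_in_c0: "c0_unit k \<in> c0"
  using sum_c0_unit_in_c0[of "{k}" "\<lambda>_. 1"] by simp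

lemma norm_sum_c0_unit_le:
  "finite F \<Longrightarrow> (\<And>k. \<bar>a k\<bar> \<le> 1) \<Longrightarrow> norm (\<Sum>k\<in>F. a k *\<^sub>R c0_unit k) \<le> 1"
  by (rule norm_bound) (simp add: sum_c0_unit_apply)

lemma one_le_norm_c0_unit: "1 \<le> norm (c0_unit k)"
  using norm_bounded[of "c0_unit k" k] by (simp add: c0_unit_apply)

text \<open>Signed sums of unit vectors stay in the unit ball of \<open>c0\<close>, so their images
  would form exactly a sequence excluded by the gliding hump.\<close>

lemma no_c0_in_james:
  fixes S :: "(nat \<Rightarrow>\<^sub>C real) \<Rightarrow> james"
  assumes lin: "\<And>x y a b. x \<in> c0 \<Longrightarrow> y \<in> c0 \<Longrightarrow> S (a *\<^sub>R x + b *\<^sub>R y) = a *\<^sub>R S x + b *\<^sub>R S y"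
    and bdd: "\<And>x. x \<in> c0 \<Longrightarrow> norm x \<le> 1 \<Longrightarrow> norm (S x) \<le> C"
    and d: "0 < d" and lower: "\<And>x. x \<in> c0 \<Longrightarrow> 1 \<le> norm x \<Longrightarrow> d \<le> norm (S x)"
  shows False
proof (rule james_no_c0_sequence[of "\<lambda>k. S (c0_unit k)" C d])
  have zero: "S 0 = 0"
    using lin[of "c0_unit 0" "c0_unit 0" 0 0] c0_unit_in_c0 by simp
  fix F :: "nat set" and a :: "nat \<Rightarrow> real" assume F: "finite F" and a: "\<And>k. \<bar>a k\<bar> \<le> 1"
  have "S (\<Sum>k\<in>F. a k *\<^sub>R c0_unit k) = (\<Sum>k\<in>F. a k *\<^sub>R S (c0_unit k))"
    using F
  proof (induction F rule: finite_induct)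
    case (insert k F)
    then show ?case
      using lin[of "c0_unit k" "\<Sum>k\<in>F. a k *\<^sub>R c0_unit k" "a k" 1] c0_unit_in_c0 sum_c0_unit_in_c0
      by simp
  qed (simp add: zero)
  then show "norm (\<Sum>k\<in>F. a k *\<^sub>R S (c0_unit k)) \<le> C"
    using bdd[OF sum_c0_unit_in_c0[OF F] norm_sum_c0_unit_le[where a = a, OF F a]] by simp
qed (use d lower[OF c0_unit_in_c0 one_le_norm_c0_unit] in auto)

section \<open>The compact space\<close>

text \<open>Points of the compact space store the extra coordinate at index 0 and a functional
  behind it; this recovers the functional.\<close>

definition tail :: "(nat \<Rightarrow> real) \<Rightarrow> nat \<Rightarrow> real" where
  "tail t i = t (Suc i)"

lemma continuous_on_tail: "continuous_on UNIV tail"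
  unfolding tail_def by (intro continuous_on_coordinatewise_then_product continuous_on_product_coordinates)

lemma bounded_linear_pairing: "u \<in> dual_ball \<Longrightarrow> bounded_linear (pairing u)"
  by (rule bounded_linear_intro[where K = 1])
     (simp_all add: pairing_add pairing_scaleR dual_ballD)

text \<open>The extra coordinate 0 makes every functional \<open>d m\<close> an isolated point of the closure.\<close>

locale norming_sequence =
  fixes d :: "nat \<Rightarrow> nat \<Rightarrow> real"
  assumes in_ball: "d m \<in> dual_ball"
    and finite_support: "finite {i. d m i \<noteq> 0}"
    and unit_in_range: "\<exists>m. d m = (\<lambda>i. if i = k then 1 else 0)"
    and norming: "e > 0 \<Longrightarrow> \<exists>m. norm x - e \<le> pairing (d m) x"
begin

definition pt :: "nat \<Rightarrow> nat \<Rightarrow> real" where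
  "pt m = case_nat (inverse (real (Suc m))) (d m)"

definition Kset :: "(nat \<Rightarrow> real) set" where
  "Kset = closure (range pt)"

text \<open>The metric of the type induces the product topology, so convergence is
  coordinatewise.\<close>

definition KM :: "(nat \<Rightarrow> real) metric" where
  "KM = submetric euclidean_metric Kset"

definition g :: "nat \<Rightarrow> (nat \<Rightarrow> real) \<Rightarrow> real" where
  "g n = (\<lambda>t\<in>Kset. tail t n)"

text \<open>The canonical evaluation map, cut down to \<open>Kset\<close> because elements of C(K)
  are extensional.\<close>

definition T :: "james \<Rightarrow> (nat \<Rightarrow> real) \<Rightarrow> real" where
  "T z = (\<lambda>t\<in>Kset. cext (pairing (tail t)) z)"

lemma mspace_KM [simp]: "mspace KM = Kset"
  by (simp add: KM_def)

lemma mtopology_of_KM: "mtopology_of KM = top_of_set Kset"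
  by (simp add: KM_def mtopology_of_submetric)

lemma pt_in_Kset: "pt m \<in> Kset"
  unfolding Kset_def using closure_subset[of "range pt"] by auto

lemma tail_pt: "tail (pt m) = d m"
  by (simp add: pt_def tail_def fun_eq_iff)

lemma pt_0: "pt m 0 = inverse (real (Suc m))"
  by (simp add: pt_def)

lemma tail_in_dual_ball: "t \<in> Kset \<Longrightarrow> tail t \<in> dual_ball"
proof -
  have "closed (tail -` dual_ball)"
    by (rule closed_vimage[OF closed_dual_ball continuous_on_tail])
  moreover have "range pt \<subseteq> tail -` dual_ball" by (auto simp: tail_pt in_ball)
  ultimately have "Kset \<subseteq> tail -` dual_ball"
    unfolding Kset_def by (rule closure_minimal[rotated])
  then show "t \<in> Kset \<Longrightarrow> tail t \<in> dual_ball" by blast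
qed

lemma abs_coord_0_le: "t \<in> Kset \<Longrightarrow> \<bar>t 0\<bar> \<le> 1"
proof -
  have "closed {t :: nat \<Rightarrow> real. \<bar>t 0\<bar> \<le> 1}"
    by (intro closed_Collect_le continuous_intros continuous_on_product_coordinates)
  moreover have "range pt \<subseteq> {t. \<bar>t 0\<bar> \<le> 1}"
    by (auto simp: pt_0 inverse_le_1_iff)
  ultimately have "Kset \<subseteq> {t. \<bar>t 0\<bar> \<le> 1}"
    unfolding Kset_def by (rule closure_minimal[rotated])
  then show "t \<in> Kset \<Longrightarrow> \<bar>t 0\<bar> \<le> 1" by blast
qed

text \<open>The coordinate bounds place this closed set inside a cube, which is compact by
  Tychonoff.\<close>

lemma compact_Kset: "compact Kset"
proof -
  have "compactin (product_topology (\<lambda>_. euclideanreal) UNIV) (PiE UNIV (\<lambda>_::nat. {-6..6::real}))"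
    unfolding compactin_PiE by simp
  then have "compact (PiE UNIV (\<lambda>_::nat. {-6..6::real}))"
    by (simp add: euclidean_product_topology)
  moreover have "Kset \<subseteq> PiE UNIV (\<lambda>_. {-6..6})"
  proof
    fix t assume t: "t \<in> Kset"
    have "\<bar>t i\<bar> \<le> 6" for i
      using abs_coord_0_le[OF t] abs_nth_dual_ball_le[OF tail_in_dual_ball[OF t], of "i - 1"]
      by (cases i) (auto simp: tail_def)
    then show "t \<in> PiE UNIV (\<lambda>_. {-6..6})" by (auto simp: abs_le_iff) (metis minus_le_iff)
  qed
  moreover have "closed Kset" by (simp add: Kset_def)
  ultimately show ?thesis by (metis compact_Int_closed inf.absorb2)
qed

lemma open_pt: "openin (top_of_set Kset) {pt m}"
proof -
  \<comment> \<open>The extra coordinate is confined between \<open>1 / (m + 2)\<close> and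
    \<open>1 / m\<close>; the upper condition is multiplied out so that it holds trivially for
    \<open>m = 0\<close>.\<close>
  define V where "V = {t :: nat \<Rightarrow> real. inverse (real (Suc (Suc m))) < t 0} \<inter> {t. t 0 * real m < 1}"
  have V: "open V"
    unfolding V_def by (intro open_Int open_Collect_less continuous_intros continuous_on_product_coordinates)
  have iff: "pt k \<in> V \<longleftrightarrow> k = m" for k
  proof -
    have "pt k \<in> V \<longleftrightarrow> Suc k < Suc (Suc m) \<and> m < Suc k"
      by (simp add: V_def pt_0 divide_simps flip: of_nat_Suc)
    then show ?thesis by auto
  qed
  \<comment> \<open>The closure adds nothing inside the open set \<open>V\<close>, because
    \<open>V\<close> meets the range in one point and a singleton is closed.\<close>
  have "V \<inter> Kset \<subseteq> closure (V \<inter> range pt)"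
    unfolding Kset_def by (rule open_Int_closure_subset[OF V])
  also have "V \<inter> range pt = {pt m}" by (auto simp: iff)
  finally have "Kset \<inter> V = {pt m}" using iff[of m] pt_in_Kset by auto
  then show ?thesis using V by (metis openin_open)
qed

lemma open_range_pt: "openin (top_of_set Kset) (range pt)"
proof -
  have "range pt = (\<Union>m. {pt m})" by auto
  then show ?thesis using open_pt by auto
qed

lemma dense_range_pt: "top_of_set Kset closure_of range pt = Kset"
proof -
  have "Kset \<inter> range pt = range pt" using pt_in_Kset by blast
  then show ?thesis by (simp add: closure_of_subtopology) (simp add: Kset_def)
qed


section \<open>The embedding\<close>

declare mspace_cfunspace [simp del]

lemma in_CK_iff: "f \<in> mspace (CK KM) \<longleftrightarrow> f \<in> extensional Kset \<and> continuous_on Kset f"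
  using compactin_mspace_cfunspace[of "top_of_set Kset" "euclidean_metric :: real metric"] compact_Kset
  by (simp add: mtopology_of_KM)

lemma T_to_completion: "t \<in> Kset \<Longrightarrow> T (to_completion x) t = pairing (tail t) x"
  by (simp add: T_def cext_to_completion bounded_linear_pairing tail_in_dual_ball)

lemma T_linear: "T (a *\<^sub>R x + b *\<^sub>R y) = (\<lambda>t\<in>mspace KM. a * T x t + b * T y t)"
  by (rule ext) (simp add: T_def cext_linear bounded_linear_pairing tail_in_dual_ball)

lemma T_diff: "t \<in> Kset \<Longrightarrow> T x t - T y t = T (x - y) t"
  using T_linear[of 1 x "-1" y] by simp

lemma abs_T_le: "t \<in> Kset \<Longrightarrow> \<bar>T z t\<bar> \<le> norm z"
  unfolding T_def by (simp add: abs_cext_le bounded_linear_pairing tail_in_dual_ball dual_ballD)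

text \<open>On finitely supported vectors only finitely many coordinates enter. A general
  \<open>z\<close> is a limit of such vectors, and the bound by the norm makes the convergence
  uniform on \<open>Kset\<close>.\<close>

lemma T_in_CK: "T z \<in> mspace (CK KM)"
proof -
  obtain X where X: "(\<lambda>n. to_completion (X n)) \<longlonglongrightarrow> z"
    using completion_limit_exists[of z] by blast
  have "uniform_limit Kset (\<lambda>n. T (to_completion (X n))) (T z) sequentially"
  proof (rule uniform_limitI)
    fix e :: real assume "e > 0"
    from tendstoD[OF X this] show "\<forall>\<^sub>F n in sequentially. \<forall>t\<in>Kset. dist (T (to_completion (X n)) t) (T z t) < e"
    proof eventually_elim
      case (elim n)
      show ?case
      proof
        fix t assume "t \<in> Kset"
        then show "dist (T (to_completion (X n)) t) (T z t) < e"
          using elim abs_T_le[of t "to_completion (X n) - z"] by (simp add: dist_norm T_diff)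
      qed
    qed
  qed
  moreover have "continuous_on Kset (T (to_completion x))" for x
  proof -
    have "continuous_on Kset (\<lambda>t. pairing (tail t) x)"
      by (rule continuous_on_compose2[OF continuous_on_pairing continuous_on_subset[OF continuous_on_tail]]) auto
    then show ?thesis
      by (rule continuous_on_eq) (simp add: T_to_completion)
  qed
  ultimately have "continuous_on Kset (T z)"
    by (intro uniform_limit_theorem[where F = sequentially]) auto
  then show ?thesis by (simp add: in_CK_iff T_def)
qed

text \<open>Functionals in the dual ball give one inequality; the norming sequence, evaluated at the
  points \<open>pt m\<close>, gives the other.\<close>

lemma T_isometry: "mdist (CK KM) (T x) (T y) = dist x y"
proof (rule antisym)
  show "mdist (CK KM) (T x) (T y) \<le> dist x y"
    by (rule mdist_cfunspace_le) (auto simp: mtopology_of_KM dist_norm T_diff abs_T_le)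
  show "dist x y \<le> mdist (CK KM) (T x) (T y)"
  proof (rule field_le_epsilon)
    fix e :: real assume "e > 0"
    \<comment> \<open>One third each for replacing \<open>x - y\<close> by \<open>v\<close> in the
      norm, for the same change in the evaluation, and for the norming defect.\<close>
    then have e: "e / 3 > 0" by simp
    obtain v where v: "dist (to_completion v) (x - y) < e / 3"
      using to_completion_approx[OF e] by blast
    obtain m where m: "norm v - e / 3 \<le> pairing (d m) v" using norming[OF e] by blast
    let ?t = "pt m"
    have "\<bar>T x ?t - T y ?t\<bar> \<le> mdist (CK KM) (T x) (T y)"
      using mdist_cfunspace_imp_mdist_le[OF T_in_CK T_in_CK order_refl, of ?t x y] pt_in_Kset
      by (simp add: mtopology_of_KM dist_norm)
    moreover have "T x ?t - T y ?t = T (to_completion v) ?t - T (to_completion v - (x - y)) ?t"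
      by (simp add: T_diff pt_in_Kset)
    moreover have "\<bar>T (to_completion v - (x - y)) ?t\<bar> < e / 3"
      using abs_T_le[OF pt_in_Kset, of "to_completion v - (x - y)" m] v by (simp add: dist_norm)
    moreover have "T (to_completion v) ?t = pairing (d m) v"
      by (simp add: T_to_completion pt_in_Kset tail_pt)
    moreover have "norm (x - y) < norm v + e / 3"
      using v norm_triangle_ineq2[of "x - y" "to_completion v"] by (simp add: dist_norm norm_minus_commute)
    ultimately show "dist x y \<le> mdist (CK KM) (T x) (T y) + e"
      using m unfolding dist_norm by linarith
  qed
qed

lemma T_trunc: "T (to_completion (trunc n a)) = (\<lambda>t\<in>mspace KM. \<Sum>i<n. a i * g i t)"
proof
  fix t
  show "T (to_completion (trunc n a)) t = (\<lambda>t\<in>mspace KM. \<Sum>i<n. a i * g i t) t"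
  proof (cases "t \<in> Kset")
    case True
    then show ?thesis by (simp add: T_to_completion pairing_trunc g_def mult.commute)
  qed (simp add: T_def)
qed

lemma span_g: "{(\<lambda>t\<in>mspace KM. \<Sum>i<n. a i * g i t) | n a. True} = range (\<lambda>x. T (to_completion x))"
proof -
  have "\<exists>n a. T (to_completion x) = T (to_completion (trunc n a))" for x
    using c00_bounded_support[of x] trunc_nth by metis
  then show ?thesis unfolding T_trunc[symmetric] by blast
qed

text \<open>The span is the image of the finitely supported vectors, which are dense in the James
  space, and an isometric image of a complete space is closed.\<close>

lemma closed_span_g: "closed_span KM g = range T"
proof -
  interpret C: Metric_space "mspace (CK KM)" "mdist (CK KM)"
    by (rule Metric_space_mspace_mdist)
  have top: "mtopology_of (CK KM) = C.mtopology" by (simp only: mtopology_of_def)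
  have mem: "f \<in> closed_span KM g \<longleftrightarrow>
      f \<in> mspace (CK KM) \<and> (\<forall>r>0. \<exists>x. mdist (CK KM) f (T (to_completion x)) < r)" for f
    unfolding closed_span_def span_g top C.metric_closure_of
    using T_in_CK by auto
  show ?thesis
  proof
    show "range T \<subseteq> closed_span KM g"
    proof clarify
      fix z :: james
      have "\<exists>x. dist z (to_completion x) < r" if "r > 0" for r
        using to_completion_approx[OF that, of z] by (simp add: dist_commute)
      then show "T z \<in> closed_span KM g"
        by (simp add: mem T_in_CK T_isometry)
    qed
    show "closed_span KM g \<subseteq> range T"
    proof
      fix f assume f: "f \<in> closed_span KM g"
      then have fC: "f \<in> mspace (CK KM)" by (simp add: mem)
      \<comment> \<open>Approximants of \<open>f\<close> in the span pull back under the isometry to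
        a Cauchy sequence in the James space; the image of its limit is \<open>f\<close>.\<close>
      have "\<forall>n. \<exists>x. mdist (CK KM) f (T (to_completion x)) < inverse (real (Suc n))"
        using f mem inverse_positive_iff_positive of_nat_0_less_iff zero_less_Suc by metis
      then obtain X where X: "\<And>n. mdist (CK KM) f (T (to_completion (X n))) < inverse (real (Suc n))"
        by metis
      let ?Y = "\<lambda>n. to_completion (X n) :: james"
      have "Cauchy ?Y"
      proof (rule metric_CauchyI)
        fix e :: real assume "e > 0"
        then obtain N where N: "inverse (real (Suc N)) < e / 2"
          using reals_Archimedean[of "e / 2"] by auto
        have small: "mdist (CK KM) f (T (?Y n)) < e / 2" if "n \<ge> N" for n
          using X[of n] N that by (smt (verit) inverse_le_iff_le of_nat_0_less_iff of_nat_mono Suc_le_mono zero_less_Suc)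
        have "dist (?Y m) (?Y n) < e" if "m \<ge> N" "n \<ge> N" for m n
          using C.triangle[OF T_in_CK fC T_in_CK, of "?Y m" "?Y n"] C.commute[of "T (?Y m)" f]
            small[OF that(1)] small[OF that(2)] unfolding T_isometry by linarith
        then show "\<exists>M. \<forall>m\<ge>M. \<forall>n\<ge>M. dist (?Y m) (?Y n) < e" by blast
      qed
      then obtain z where z: "?Y \<longlonglongrightarrow> z" by (auto simp: Cauchy_convergent_iff convergent_def)
      have "(\<lambda>n. inverse (real (Suc n)) + dist (?Y n) z) \<longlonglongrightarrow> 0 + 0"
        by (rule tendsto_add[OF LIMSEQ_inverse_real_of_nat iffD1[OF tendsto_dist_iff z]])
      moreover have "mdist (CK KM) f (T z) \<le> inverse (real (Suc n)) + dist (?Y n) z" for n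
        using C.triangle[OF fC T_in_CK[of "?Y n"] T_in_CK[of z]] X[of n] unfolding T_isometry by linarith
      ultimately have "mdist (CK KM) f (T z) \<le> 0 + 0"
        by (intro LIMSEQ_le_const) blast+
      then have "mdist (CK KM) f (T z) = 0" using C.nonneg[of f "T z"] by linarith
      then have "f = T z" using C.zero[OF fC T_in_CK] by blast
      then show "f \<in> range T" by blast
    qed
  qed
qed

lemma T_homeomorphic: "homeomorphic_map euclidean (subtopology (mtopology_of (CK KM)) (range T)) T"
proof -
  interpret Metric_space12 "UNIV :: james set" dist "mspace (CK KM)" "mdist (CK KM)"
    by (intro Metric_space12.intro Metric_space_mspace_mdist Met_TC.Metric_space_axioms)
  have "embedding_map Met_TC.mtopology (Metric_space.mtopology (mspace (CK KM)) (mdist (CK KM))) T"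
    by (rule isometry_imp_embedding_map) (use T_in_CK T_isometry in blast)+
  moreover have "Metric_space.mtopology (mspace (CK KM)) (mdist (CK KM)) = mtopology_of (CK KM)"
    by (simp only: mtopology_of_def)
  ultimately show ?thesis by (simp add: embedding_map_def)
qed

lemma james_isomorphic: "isomorphic_CK (UNIV :: james set) KM (closed_span KM g)"
  unfolding isomorphic_CK_def closed_span_g
  using T_homeomorphic T_linear by (intro exI[of _ T]) simp

text \<open>An embedding \<open>V\<close> is pulled back through the isometry \<open>T\<close> to a
  linear map into the James space. Continuity at 0 of this map and of its inverse gives the two
  bounds that \<open>no_c0_in_james\<close> excludes.\<close>

lemma no_c0: "\<not> c0_embeds KM (closed_span KM g)"
proof
  assume "c0_embeds KM (closed_span KM g)"
  then obtain B V where B: "B \<subseteq> range T"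
    and V: "homeomorphic_map (top_of_set c0) (subtopology (mtopology_of (CK KM)) B) V"
    and lin: "\<And>x y a b. x \<in> c0 \<Longrightarrow> y \<in> c0 \<Longrightarrow>
      V (a *\<^sub>R x + b *\<^sub>R y) = (\<lambda>t\<in>mspace KM. a * V x t + b * V y t)"
    unfolding c0_embeds_def isomorphic_CK_def closed_span_g by blast
  let ?X = "mtopology_of (CK KM)"
  obtain W where W: "homeomorphic_maps (top_of_set c0) (subtopology ?X B) V W"
    using V homeomorphic_map_maps by blast
  obtain R where R: "homeomorphic_maps euclidean (subtopology ?X (range T)) T R"
    using T_homeomorphic homeomorphic_map_maps by blast
  have RT: "R (T z) = z" for z using R by (simp add: homeomorphic_maps_def)
  have WV: "W (V x) = x" if "x \<in> c0" for x using W that by (simp add: homeomorphic_maps_def)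
  have VB: "V x \<in> B" if "x \<in> c0" for x
    using W that by (auto simp: homeomorphic_maps_def continuous_map_def Pi_iff)
  define S where "S x = R (V x)" for x
  have TS: "T (S x) = V x" if "x \<in> c0" for x
    using VB[OF that] B RT by (auto simp: S_def)
  have S_lin: "S (a *\<^sub>R x + b *\<^sub>R y) = a *\<^sub>R S x + b *\<^sub>R S y" if "x \<in> c0" "y \<in> c0" for x y a b
  proof -
    have "V (a *\<^sub>R x + b *\<^sub>R y) = T (a *\<^sub>R S x + b *\<^sub>R S y)"
      using lin[OF that] TS that by (simp add: T_linear)
    then show ?thesis by (simp add: S_def RT)
  qed
  have zero: "(0 :: nat \<Rightarrow>\<^sub>C real) \<in> c0" by (simp add: c0_def zero_bcontfun.rep_eq)
  have scale: "a *\<^sub>R x \<in> c0" if "x \<in> c0" for a x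
    using that tendsto_mult_right_zero[of "apply_bcontfun x" sequentially a]
    by (simp add: c0_def scaleR_bcontfun.rep_eq)
  have S0: "S 0 = 0" using S_lin[OF zero zero, of 0 0] by simp
  have "continuous_map (top_of_set c0) euclidean S"
  proof -
    have "continuous_map (top_of_set c0) (subtopology ?X (range T)) V"
    proof (rule continuous_map_into_subtopology)
      have "continuous_map (top_of_set c0) (subtopology ?X B) V"
        using W unfolding homeomorphic_maps_def by blast
      then show "continuous_map (top_of_set c0) ?X V" by (rule continuous_map_into_fulltopology)
      show "V \<in> topspace (top_of_set c0) \<rightarrow> range T" using VB B by auto
    qed
    moreover have "continuous_map (subtopology ?X (range T)) euclidean R"
      using R unfolding homeomorphic_maps_def by blast
    ultimately have "continuous_map (top_of_set c0) euclidean (R \<circ> V)"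
      by (rule continuous_map_compose)
    then show ?thesis by (simp add: S_def[abs_def] comp_def)
  qed
  then have "continuous_on c0 S" by simp
  then obtain r where r: "r > 0" and r1: "\<And>x. x \<in> c0 \<Longrightarrow> norm x < r \<Longrightarrow> norm (S x) < 1"
    using zero S0 zero_less_one[where 'a = real] unfolding continuous_on_iff
    by (metis dist_norm diff_zero)
  \<comment> \<open>Scaling by \<open>r / 2\<close> puts the unit ball strictly inside the radius
    \<open>r\<close>.\<close>
  have bdd: "norm (S x) \<le> 2 / r" if x: "x \<in> c0" "norm x \<le> 1" for x
  proof -
    have "norm ((r / 2) *\<^sub>R x) \<le> r / 2 * 1"
      using r x(2) by (simp only: norm_scaleR) (intro mult_mono, auto)
    then have "norm (S ((r / 2) *\<^sub>R x)) < 1" using r scale[OF x(1)] by (intro r1) auto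
    moreover have "S ((r / 2) *\<^sub>R x) = (r / 2) *\<^sub>R S x"
      using S_lin[OF x(1) zero, of "r / 2" 0] by simp
    ultimately show ?thesis using r by (simp add: field_simps)
  qed
  have "continuous_map (top_of_set (S ` c0)) (top_of_set c0) (W \<circ> T)"
  proof (rule continuous_map_compose)
    have "continuous_map euclidean ?X T"
      using R unfolding homeomorphic_maps_def by (blast intro: continuous_map_into_fulltopology)
    then show "continuous_map (top_of_set (S ` c0)) (subtopology ?X B) T"
      using TS VB by (intro continuous_map_into_subtopology continuous_map_from_subtopology) auto
    show "continuous_map (subtopology ?X B) (top_of_set c0) W"
      using W unfolding homeomorphic_maps_def by blast
  qed
  then have "continuous_on (S ` c0) (W \<circ> T)"
    using continuous_map_into_fulltopology by (metis continuous_map_iff_continuous)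
  moreover have WTS: "(W \<circ> T) (S x) = x" if "x \<in> c0" for x using that TS WV by simp
  moreover have "0 \<in> S ` c0" using S0 zero by force
  \<comment> \<open>Continuity of the inverse at 0: norm of \<open>S x\<close> below
    \<open>q\<close> forces norm of \<open>x\<close> below 1. The contrapositive is the lower
    bound.\<close>
  ultimately obtain q where q: "q > 0"
    and q1: "\<And>y. y \<in> S ` c0 \<Longrightarrow> norm y < q \<Longrightarrow> norm ((W \<circ> T) y) < 1"
    using WTS[OF zero, unfolded S0] zero_less_one[where 'a = real] unfolding continuous_on_iff
    by (metis dist_norm diff_zero)
  show False
  proof (rule no_c0_in_james[of S "2 / r" q])
    show "q \<le> norm (S x)" if "x \<in> c0" "1 \<le> norm x" for x
      using q1[of "S x"] WTS[OF that(1)] that by force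
  qed (use S_lin bdd q in auto)
qed


section \<open>The partial sums\<close>

lemma g_in_CK: "g n \<in> mspace (CK KM)"
proof -
  have "continuous_on Kset (\<lambda>t. t (Suc n))"
    by (rule continuous_on_subset[OF continuous_on_product_coordinates]) simp
  then have "continuous_on Kset (g n)"
    by (rule continuous_on_eq) (simp add: g_def tail_def)
  then show ?thesis by (simp add: in_CK_iff g_def)
qed

lemma partial_sums_g: "t \<in> Kset \<Longrightarrow> (\<Sum>i\<le>n. g i t) = (\<Sum>i<Suc n. tail t i)"
  by (simp add: g_def lessThan_Suc_atMost)

lemma partial_sums_bounded: "t \<in> Kset \<Longrightarrow> \<bar>\<Sum>i\<le>n. g i t\<bar> \<le> 3"
  unfolding partial_sums_g by (rule abs_partial_sum_dual_ball_le[OF tail_in_dual_ball])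

lemma partial_sums_converge: "t \<in> Kset \<Longrightarrow> (\<lambda>n. \<Sum>i\<le>n. g i t) \<longlonglongrightarrow> lim (\<lambda>n. \<Sum>i<n. tail t i)"
  unfolding partial_sums_g
  by (rule LIMSEQ_Suc, rule convergent_LIMSEQ_iff[THEN iffD1])
     (rule convergent_partial_sums_dual_ball[OF tail_in_dual_ball])

lemma limit_discontinuous:
  assumes f: "\<forall>t\<in>Kset. (\<lambda>n. \<Sum>i\<le>n. g i t) \<longlonglongrightarrow> f t"
  shows "\<not> continuous_on Kset f"
proof
  assume cont: "continuous_on Kset f"
  obtain m where m: "\<And>k. d (m k) = (\<lambda>i. if i = k then 1 else 0)"
    using unit_in_range by metis
  have "inj m"
  proof (rule injI)
    fix j k assume "m j = m k"
    then have "d (m j) j = d (m k) j" by simp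
    then show "j = k" by (simp add: m split: if_splits)
  qed
  \<comment> \<open>An injective map leaves every finite set, so the extra coordinates
    \<open>1 / (m k + 1)\<close> tend to 0.\<close>
  have lim_m: "filterlim m sequentially sequentially"
    unfolding filterlim_at_top
  proof
    fix Z
    have "finite (m -` {..<Z})" using \<open>inj m\<close> by (intro finite_vimageI) auto
    moreover have "m -` {..<Z} = {k. \<not> Z \<le> m k}" by auto
    ultimately show "\<forall>\<^sub>F k in sequentially. Z \<le> m k"
      by (simp only: cofinite_eq_sequentially[symmetric] eventually_cofinite)
  qed
  have to_0: "(\<lambda>k. pt (m k) i) \<longlonglongrightarrow> 0" for i
  proof (cases i)
    case 0
    then show ?thesis
      using filterlim_compose[OF LIMSEQ_inverse_real_of_nat lim_m] by (simp add: pt_0)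
  next
    case (Suc j)
    have "\<forall>\<^sub>F k in sequentially. j < k" by (rule eventually_gt_at_top)
    then have "\<forall>\<^sub>F k in sequentially. pt (m k) i = 0"
      by eventually_elim (simp add: Suc pt_def m)
    then show ?thesis by (rule tendsto_eventually)
  qed
  have lim_pt: "(\<lambda>k. pt (m k)) \<longlonglongrightarrow> (\<lambda>i. 0)"
    using to_0 limitin_componentwise[of "\<lambda>_. euclideanreal" UNIV "\<lambda>k. pt (m k)" "\<lambda>i. 0" sequentially]
    by (simp add: euclidean_product_topology)
  have 0: "(\<lambda>i. 0) \<in> Kset"
    by (rule closed_sequentially[OF _ pt_in_Kset lim_pt]) (simp add: Kset_def)
  have "f (\<lambda>i. 0) = 0"
  proof (rule LIMSEQ_unique)
    show "(\<lambda>n. \<Sum>i\<le>n. g i (\<lambda>i. 0)) \<longlonglongrightarrow> f (\<lambda>i. 0)" using f 0 by blast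
    show "(\<lambda>n. \<Sum>i\<le>n. g i (\<lambda>i. 0)) \<longlonglongrightarrow> 0" using 0 by (simp add: g_def tail_def)
  qed
  moreover have "f (pt (m k)) = 1" for k
  proof (rule LIMSEQ_unique)
    show "(\<lambda>n. \<Sum>i\<le>n. g i (pt (m k))) \<longlonglongrightarrow> f (pt (m k))" using f pt_in_Kset by blast
    have "\<forall>\<^sub>F n in sequentially. k \<le> n" by (rule eventually_ge_at_top)
    then have "\<forall>\<^sub>F n in sequentially. (\<Sum>i\<le>n. g i (pt (m k))) = 1"
      by eventually_elim (simp add: g_def pt_in_Kset tail_pt m)
    then show "(\<lambda>n. \<Sum>i\<le>n. g i (pt (m k))) \<longlonglongrightarrow> 1" by (rule tendsto_eventually)
  qed
  moreover have "(\<lambda>k. f (pt (m k))) \<longlonglongrightarrow> f (\<lambda>i. 0)"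
    by (rule continuous_on_tendsto_compose[OF cont lim_pt 0]) (simp add: pt_in_Kset)
  ultimately show False using LIMSEQ_unique[OF tendsto_const, of "1::real" 0] by simp
qed

lemma eventually_0_on_range_pt: "u \<in> range pt \<Longrightarrow> \<exists>n. \<forall>m\<ge>n. g m u = 0"
proof -
  assume "u \<in> range pt"
  then obtain k where u: "u = pt k" by blast
  obtain n where "\<forall>i\<in>{i. d k i \<noteq> 0}. i < n"
    using finite_support[of k] finite_nat_bounded by blast
  then have "\<forall>i\<ge>n. d k i = 0" by (meson linorder_not_le mem_Collect_eq)
  then show ?thesis by (auto simp: u g_def pt_in_Kset tail_pt)
qed

end

section \<open>Assembling the example from a countable norming set\<close>

theorem mainTheorem1:
  shows "\<exists>(K :: (nat \<Rightarrow> real) metric) U (g :: nat \<Rightarrow> (nat \<Rightarrow> real) \<Rightarrow> real).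
    compact_space (mtopology_of K) \<and>
    openin (mtopology_of K) U \<and>
    mtopology_of K closure_of U = mspace K \<and>
    (\<forall>n. g n \<in> mspace (CK K)) \<and>
    (\<exists>C. \<forall>n. \<forall>t\<in>mspace K. \<bar>\<Sum>i\<le>n. g i t\<bar> \<le> C) \<and>
    (\<exists>f. (\<forall>t\<in>mspace K. (\<lambda>n. \<Sum>i\<le>n. g i t) \<longlonglongrightarrow> f t) \<and>
         \<not> continuous_map (mtopology_of K) euclideanreal f) \<and>
    (\<forall>u\<in>U. \<exists>n. \<forall>m\<ge>n. g m u = 0) \<and>
    isomorphic_CK (UNIV :: james set) K (closed_span K g) \<and>
    \<not> c0_embeds K (closed_span K g)"
proof -
  obtain D where D: "countable D" "D \<subseteq> dual_ball" "\<And>u. u \<in> D \<Longrightarrow> finite {i. u i \<noteq> 0}"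
    "\<And>k. (\<lambda>i. if i = k then 1 else 0) \<in> D" "\<And>x e. e > 0 \<Longrightarrow> \<exists>u\<in>D. norm x - e \<le> pairing u x"
    by (rule countable_norming_set, rule that)
  have "D \<noteq> {}" using D(4) by auto
  \<comment> \<open>The enumeration reaches all of \<open>D\<close>, so the coordinate functionals
    and the norming property pass to the sequence.\<close>
  have ex: "\<exists>m. from_nat_into D m = u" if "u \<in> D" for u
    using from_nat_into_surj[OF D(1) that] .
  have mem: "from_nat_into D m \<in> D" for m by (rule from_nat_into[OF \<open>D \<noteq> {}\<close>])
  interpret norming_sequence "from_nat_into D"
  proof
    show "from_nat_into D m \<in> dual_ball" "finite {i. from_nat_into D m i \<noteq> 0}" for m
      using D(2,3) mem[of m] by auto
    show "\<exists>m. from_nat_into D m = (\<lambda>i. if i = k then 1 else 0)" for k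
      by (rule ex) (rule D(4))
    show "\<exists>m. norm x - e \<le> pairing (from_nat_into D m) x" if e: "e > 0" for x e
    proof -
      obtain u where "u \<in> D" "norm x - e \<le> pairing u x" using D(5)[OF e] by blast
      then show ?thesis using ex by metis
    qed
  qed
  let ?f = "\<lambda>t. lim (\<lambda>n. \<Sum>i<n. tail t i)"
  show ?thesis
  proof (intro exI[of _ KM] exI[of _ "range pt"] exI[of _ g] conjI)
    show "compact_space (mtopology_of KM)" using compact_Kset by (simp add: mtopology_of_KM compact_space_subtopology)
    show "openin (mtopology_of KM) (range pt)" by (simp add: mtopology_of_KM open_range_pt)
    show "mtopology_of KM closure_of range pt = mspace KM" by (simp add: mtopology_of_KM dense_range_pt)
    show "\<forall>n. g n \<in> mspace (CK KM)" using g_in_CK by blast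
    show "\<exists>C. \<forall>n. \<forall>t\<in>mspace KM. \<bar>\<Sum>i\<le>n. g i t\<bar> \<le> C"
      using partial_sums_bounded by auto
    show "\<exists>f. (\<forall>t\<in>mspace KM. (\<lambda>n. \<Sum>i\<le>n. g i t) \<longlonglongrightarrow> f t) \<and>
        \<not> continuous_map (mtopology_of KM) euclideanreal f"
      using partial_sums_converge limit_discontinuous[of ?f] by (intro exI[of _ ?f]) (simp add: mtopology_of_KM)
    show "\<forall>u\<in>range pt. \<exists>n. \<forall>m\<ge>n. g m u = 0" using eventually_0_on_range_pt by blast
  qed (rule james_isomorphic no_c0)+
qed

end
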